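(* There is a $\Sigma^0_3$ predicate $C(\alpha,\nu)$ on $\{0,1\}^{\mathbb{N}}\times\{0,1\}^{\mathbb{N}}$ such that for all $\alpha,\nu\in\{0,1\}^{\mathbb{N}}$: \[ C(\alpha,\nu) \iff \big(\nu \in \mathrm{MIN}(\Phi(\alpha)) \ \wedge\ \alpha\in KC\big),\] where $\nu$ is identified with the real number in $[0,1]$ having binary expansion $\nu$.
   Context: $\Sigma^0_3$ refers to the arithmetical hierarchy on subsets of $\{0,1\}^{\mathbb{N}}\times\{0,1\}^{\mathbb{N}}$. For a finite binary word $a$, $K(a)$ denotes its prefix-free Kolmogorov complexity; $\overline{\alpha}(n)=\alpha_0\cdots\alpha_{n-1}$. $KC$ is the set of infinite binary sequences $\alpha$ such that for some $d$, $K(\overline{\alpha}(n))\ge n-d$ for all $n$. A complex oscillation is a function $x\in C[0,1]$ for which there exist $d>0$ and functions $x_n$ ($n\ge1$), where $x_n$ vanishes at $0$ and is linear with slope $\pm\sqrt n$ on each $[(i-1)/n,i/n]$, such that the binary code of $x_n$ (bit $i$ is $1$ iff $x_n$ increases on the $i$-th interval) has prefix-free complexity $\ge n-d$, and $\|x-x_n\|_\infty\to0$ effectively (with a total recursive modulus). $\Phi$ is Fouché's bijection from $KC$ onto the set of complex oscillations: from $\alpha\in KC$ one computes reals $\xi_0,\xi_1,\xi_{jn}$ ($j\ge1$, $0\le n<2^j$), computably in $\alpha,j,n$, sets $x(1)=\xi_0$, $2x(1/2)=\xi_0+\xi_1$, $2x((2n+1)/2^{j+1})=2^{-j/2}\xi_{jn}+x((n+1)/2^j)+x(n/2^j)$,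 and $\Phi(\alpha)$ is the unique continuous function with value $x(d)$ at every dyadic rational $d$; the values $\Phi(\alpha)(t)$ at dyadic $t$ are computable uniformly from $\alpha$. For continuous $x$ on $[0,1]$, $\mathrm{MIN}(x)$ is its set of local minimizers: points $t$ such that for some closed interval $I\subseteq[0,1]$ containing $t$, $x$ attains its minimum over $I$ at $t$. *)

theory Defs
  imports
    Complex_Main
    "HOL-Library.Extended_Nat"
    "HOL-Library.FuncSet"
    "HOL-Library.Nat_Bijection"
    "HOL-Library.Sublist"
begin

section \<open>Partial recursive functions with Cantor space oracles\<close>

type_synonym cantor = "nat \<Rightarrow> bool"

datatype prog =
    Zero
  | Succ
  | Proj nat
  | Oracle nat
  | Comp prog "prog list"
  | PrimRec prog prog
  | Mu prog

text \<open>\<open>computes As p xs y\<close>: program \<open>p\<close> with oracles \<open>As\<close> halts on input \<open>xs\<close> with output \<open>y\<close>.\<close>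

inductive computes :: "cantor list \<Rightarrow> prog \<Rightarrow> nat list \<Rightarrow> nat \<Rightarrow> bool" for As where
  Zero: "computes As Zero xs 0"
| Succ: "computes As Succ [x] (Suc x)"
| Proj: "i < length xs \<Longrightarrow> computes As (Proj i) xs (xs ! i)"
| Oracle: "i < length As \<Longrightarrow> computes As (Oracle i) [x] (of_bool ((As ! i) x))"
| Comp: "list_all2 (\<lambda>g y. computes As g xs y) gs ys \<Longrightarrow> computes As f ys z \<Longrightarrow> computes As (Comp f gs) xs z"
| PrimRec_0: "computes As f xs y \<Longrightarrow> computes As (PrimRec f g) (0 # xs) y"
| PrimRec_Suc: "computes As (PrimRec f g) (n # xs) y \<Longrightarrow> computes As g (n # y # xs) z \<Longrightarrow>
    computes As (PrimRec f g) (Suc n # xs) z"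
| Mu: "computes As f (n # xs) 0 \<Longrightarrow> (\<And>m. m < n \<Longrightarrow> \<exists>y>0. computes As f (m # xs) y) \<Longrightarrow>
    computes As (Mu f) xs n"

definition total_recursive :: "(nat \<Rightarrow> nat) \<Rightarrow> bool" where
  "total_recursive g \<longleftrightarrow> (\<exists>p. \<forall>m. computes [] p [m] (g m))"

text \<open>Lightface: the matrix \<open>R\<close> is decided by a single program with both sequences as oracles.\<close>

definition Sigma03 :: "(cantor \<Rightarrow> cantor \<Rightarrow> bool) \<Rightarrow> bool" where
  "Sigma03 C \<longleftrightarrow> (\<exists>R.
     (\<exists>p. \<forall>\<alpha> \<nu> a b c. computes [\<alpha>, \<nu>] p [a, b, c] (of_bool (R \<alpha> \<nu> a b c))) \<and>
     (\<forall>\<alpha> \<nu>. C \<alpha> \<nu> \<longleftrightarrow> (\<exists>a. \<forall>b. \<exists>c. R \<alpha> \<nu> a b c)))"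

text \<open>A family of reals \<open>F \<alpha> xs\<close> that is computable uniformly in \<open>\<alpha> \<in> S\<close> and \<open>xs \<in> D\<close>: one program
  produces the numerator of a dyadic approximation of any requested precision. It may diverge
  for oracles outside \<open>S\<close>.\<close>

definition computable_reals_on ::
    "cantor set \<Rightarrow> nat list set \<Rightarrow> (cantor \<Rightarrow> nat list \<Rightarrow> real) \<Rightarrow> bool" where
  "computable_reals_on S D F \<longleftrightarrow> (\<exists>p. \<forall>\<alpha>\<in>S. \<forall>xs\<in>D. \<forall>k. \<exists>m. computes [\<alpha>] p (k # xs) m \<and>
     \<bar>F \<alpha> xs - of_int (int_decode m) / 2 ^ k\<bar> \<le> 1 / 2 ^ k)"


section \<open>Prefix-free Kolmogorov complexity\<close>

text \<open>The bijective base 2 numbering of binary words.\<close>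

primrec word_code :: "bool list \<Rightarrow> nat" where
  "word_code [] = 0"
| "word_code (b # w) = 2 * word_code w + (if b then 2 else 1)"

lemma bij_word_code: "bij word_code"
proof (rule bijI)
  show "inj word_code"
  proof (rule injI)
    fix u v show "word_code u = word_code v \<Longrightarrow> u = v"
    proof (induction u arbitrary: v)
      case Nil then show ?case by (cases v) (auto split: if_splits)
    next
      case (Cons b u)
      show ?case
      proof (cases v)
        case Nil
        then show ?thesis using Cons.prems by (simp split: if_splits)
      next
        case (Cons c v')
        then have *: "2 * word_code u + (if b then 2 else 1) = 2 * word_code v' + (if c then 2 else 1)"
          using Cons.prems by simp
        then have "b = c" by (cases b; cases c; simp; presburger)
        with * have "word_code u = word_code v'" by simp
        then show ?thesis using Cons.IH \<open>b = c\<close> \<open>v = c # v'\<close> by simp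
      qed
    qed
  qed
  have "\<exists>w. n = word_code w" for n
  proof (induction n rule: less_induct)
    case (less n)
    show ?case
    proof (cases "n = 0")
      case True then have "n = word_code []" by simp
      then show ?thesis by blast
    next
      case False
      then have "(n - 1) div 2 < n" by linarith
      then obtain w where "(n - 1) div 2 = word_code w" using less by blast
      then have "n = word_code (even n # w)" using False by simp presburger
      then show ?thesis by blast
    qed
  qed
  then show "surj word_code" by (simp add: surj_def)
qed

type_synonym machine = "bool list \<Rightarrow> bool list option"

definition prefix_free_machine :: "machine \<Rightarrow> bool" where
  "prefix_free_machine M \<longleftrightarrow>
     (\<exists>p. \<forall>u v. computes [] p [word_code u] (word_code v) \<longleftrightarrow> M u = Some v) \<and>
     (\<forall>u\<in>dom M. \<forall>v\<in>dom M. prefix u v \<longrightarrow> u = v)"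

definition complexity :: "machine \<Rightarrow> bool list \<Rightarrow> enat" where
  "complexity M w = (INF u\<in>{u. M u = Some w}. enat (length u))"

text \<open>The prefix-free Kolmogorov complexity \<open>K\<close> is \<open>complexity U\<close> for an optimal \<open>U\<close>;
  it is finite everywhere, and determined by this up to an additive constant.\<close>

definition optimal_machine :: "machine \<Rightarrow> bool" where
  "optimal_machine U \<longleftrightarrow> prefix_free_machine U \<and>
     (\<forall>M. prefix_free_machine M \<longrightarrow> (\<exists>c. \<forall>w. complexity U w \<le> complexity M w + enat c))"

definition KC :: "machine \<Rightarrow> cantor set" where
  "KC U = {\<alpha>. \<exists>d. \<forall>n. enat n \<le> complexity U (map \<alpha> [0..<n]) + enat d}"


section \<open>Complex oscillations\<close>

definition scaled_walk :: "nat \<Rightarrow> (real \<Rightarrow> real) \<Rightarrow> bool" where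
  "scaled_walk n f \<longleftrightarrow> f 0 = 0 \<and> (\<forall>i<n. \<exists>s\<in>{- sqrt n, sqrt n}. \<forall>t\<in>{real i / n..real (Suc i) / n}.
     f t = f (real i / n) + s * (t - real i / n))"

definition walk_code :: "nat \<Rightarrow> (real \<Rightarrow> real) \<Rightarrow> bool list" where
  "walk_code n f = map (\<lambda>i. f (real i / n) < f (real (Suc i) / n)) [0..<n]"

text \<open>Elements of \<open>C[0,1]\<close> are represented by functions that are \<open>undefined\<close> outside \<open>[0,1]\<close>.\<close>

definition complex_oscillations :: "machine \<Rightarrow> (real \<Rightarrow> real) set" where
  "complex_oscillations U = {x \<in> extensional {0..1}. continuous_on {0..1} x \<and>
     (\<exists>d>0. \<exists>xs :: nat \<Rightarrow> real \<Rightarrow> real.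
        (\<forall>n\<ge>1. scaled_walk n (xs n) \<and> enat n \<le> complexity U (walk_code n (xs n)) + enat d) \<and>
        (\<exists>g. total_recursive g \<and>
           (\<forall>m. \<forall>n\<ge>max 1 (g m). \<forall>t\<in>{0..1}. \<bar>x t - xs n t\<bar> \<le> 1 / (m + 1))))}"


section \<open>From random sequences to complex oscillations\<close>

definition dyadic_recursion :: "real \<Rightarrow> real \<Rightarrow> (nat \<Rightarrow> nat \<Rightarrow> real) \<Rightarrow> (real \<Rightarrow> real) \<Rightarrow> bool" where
  "dyadic_recursion \<xi>0 \<xi>1 \<xi> x \<longleftrightarrow>
     x 0 = 0 \<and> x 1 = \<xi>0 \<and> 2 * x (1 / 2) = \<xi>0 + \<xi>1 \<and>
     (\<forall>j\<ge>1. \<forall>n<2 ^ j. 2 * x ((2 * real n + 1) / 2 ^ (j + 1)) =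
        2 powr (- (real j / 2)) * \<xi> j n + x ((real n + 1) / 2 ^ j) + x (real n / 2 ^ j))"

text \<open>A bijection from \<open>KC\<close> onto the complex oscillations given by coefficients that are
  computable from \<open>\<alpha>\<close>. As \<open>\<Phi> \<alpha>\<close> is continuous, it is determined by \<open>dyadic_recursion\<close>.\<close>

definition fouche_bijection :: "machine \<Rightarrow> (cantor \<Rightarrow> real \<Rightarrow> real) \<Rightarrow> bool" where
  "fouche_bijection U \<Phi> \<longleftrightarrow>
     bij_betw \<Phi> (KC U) (complex_oscillations U) \<and>
     (\<exists>\<xi>0 \<xi>1 \<xi>.
        computable_reals_on (KC U) {[]} (\<lambda>\<alpha> _. \<xi>0 \<alpha>) \<and>
        computable_reals_on (KC U) {[]} (\<lambda>\<alpha> _. \<xi>1 \<alpha>) \<and>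
        computable_reals_on (KC U) {[j, n] | j n. 1 \<le> j \<and> n < 2 ^ j} (\<lambda>\<alpha> xs. \<xi> \<alpha> (xs ! 0) (xs ! 1)) \<and>
        (\<forall>\<alpha>\<in>KC U. dyadic_recursion (\<xi>0 \<alpha>) (\<xi>1 \<alpha>) (\<xi> \<alpha>) (\<Phi> \<alpha>)))"


section \<open>Local minimizers\<close>

text \<open>The interval must be nondegenerate: otherwise every point would qualify.\<close>

definition local_minimizers :: "(real \<Rightarrow> real) \<Rightarrow> real set" where
  "local_minimizers x = {t. \<exists>a b. 0 \<le> a \<and> a < b \<and> b \<le> 1 \<and> t \<in> {a..b} \<and> (\<forall>s\<in>{a..b}. x t \<le> x s)}"

definition binary_real :: "cantor \<Rightarrow> real" where
  "binary_real \<nu> = (\<Sum>i. of_bool (\<nu> i) / 2 ^ (i + 1))"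

end

theory Submission
  imports Defs
begin

text \<open>Membership in \<open>KC\<close> is \<open>\<exists>d. \<forall>n\<close> followed by a co-r.e. condition, hence \<open>\<Sigma>\<^sup>0\<^sub>2\<close>. For \<open>\<alpha> \<in> KC\<close> the point
  \<open>t\<close> with expansion \<open>\<nu>\<close> is a local minimizer iff it minimizes \<open>x = \<Phi> \<alpha>\<close> on \<open>[t, t + 2\<^sup>-\<^sup>J]\<close> or on
  \<open>[t - 2\<^sup>-\<^sup>J, t]\<close> for some \<open>J\<close>, and by continuity only the dyadic points \<open>q\<close> of that interval matter.
  For the \<open>k\<close>-digit truncations \<open>t\<^sub>k\<close> of \<open>t\<close>, continuity also makes \<open>x t \<le> x q\<close> equivalent to the
  \<open>\<Pi>\<^sup>0\<^sub>2\<close> condition \<open>\<forall>N. \<exists>k\<ge>N. x t\<^sub>k < x q + 2\<^sup>-\<^sup>N\<close>, so no modulus of continuity is needed. The values of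
  \<open>x\<close> at dyadic points are finite Faber-Schauder sums of the computable coefficients. The programs that
  compute them may diverge for \<open>\<alpha> \<notin> KC\<close>, so they enter the decidable matrix only through their
  bounded simulation, whose bound is absorbed by the innermost existential quantifier.\<close>

section \<open>Functions computable from two oracles\<close>

text \<open>The interval of a minimizer may have it as an endpoint, so a two-sided neighbourhood
  would lose points. An interval that is nondegenerate always leaves room on at least one side,
  hence the choice of a side. The order of computable reals is not decidable. The comparison is
  therefore made with a tolerance: the test must accept below 2^-N, may do anything up to 9 * 2^-N,
  and the gap closes as N grows. The prefix is then counted out: the randomness constant, J and the
  side are guessed first; the data of all tests are universal; the truncation length k and the
  simulation bound come last. Both conjuncts share this prefix through coded tuples. Outside
  \<open>KC U\<close> the simulated comparison may give nonsense. This is harmless: there every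
  guessed constant is refuted by the randomness conjunct, at some value of the universal variable
  and whatever the last variable is.\<close>

type_synonym functional = "cantor \<Rightarrow> cantor \<Rightarrow> nat list \<Rightarrow> nat"

text \<open>Convergence is demanded only for first oracles in \<open>S\<close>, because the
  coefficient programs are only known to converge on \<open>KC U\<close>. The matrix of the final
  predicate is shown computable with \<open>S = UNIV\<close>. The arity \<open>n\<close> is fixed
  for each functional.\<close>

definition computable :: "cantor set \<Rightarrow> nat \<Rightarrow> functional \<Rightarrow> bool" where
  "computable S n F \<longleftrightarrow> (\<exists>p. \<forall>\<alpha>\<in>S. \<forall>\<nu> xs. length xs = n \<longrightarrow> computes [\<alpha>, \<nu>] p xs (F \<alpha> \<nu> xs))"

named_theorems computable_intros

lemma computableE:
  assumes "computable S n F"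
  obtains p where "\<And>\<alpha> \<nu> xs. \<alpha> \<in> S \<Longrightarrow> length xs = n \<Longrightarrow> computes [\<alpha>, \<nu>] p xs (F \<alpha> \<nu> xs)"
  using assms unfolding computable_def by metis

lemma computable_cong:
  assumes "computable S n F" "\<And>\<alpha> \<nu> xs. \<alpha> \<in> S \<Longrightarrow> length xs = n \<Longrightarrow> F \<alpha> \<nu> xs = G \<alpha> \<nu> xs"
  shows "computable S n G"
  using assms unfolding computable_def by metis

text \<open>Here \<open>p\<close> only has to be correct on the tuples that the inner functions
  actually produce. This covers programs that may diverge on other inputs.\<close>

lemma computable_Comp:
  assumes p: "\<And>\<alpha> \<nu> xs. \<alpha> \<in> S \<Longrightarrow> length xs = n \<Longrightarrow>
      computes [\<alpha>, \<nu>] p (map (\<lambda>g. g \<alpha> \<nu> xs) gs) (F \<alpha> \<nu> xs)"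
    and gs: "\<And>g. g \<in> set gs \<Longrightarrow> computable S n g"
  shows "computable S n F"
proof -
  have "\<forall>g\<in>set gs. \<exists>q. \<forall>\<alpha>\<in>S. \<forall>\<nu> xs. length xs = n \<longrightarrow> computes [\<alpha>, \<nu>] q xs (g \<alpha> \<nu> xs)"
    using gs unfolding computable_def by blast
  then obtain h where h: "\<And>g \<alpha> \<nu> xs. g \<in> set gs \<Longrightarrow> \<alpha> \<in> S \<Longrightarrow> length xs = n \<Longrightarrow>
      computes [\<alpha>, \<nu>] (h g) xs (g \<alpha> \<nu> xs)"
    by metis
  have "computes [\<alpha>, \<nu>] (Comp p (map h gs)) xs (F \<alpha> \<nu> xs)" if "\<alpha> \<in> S" "length xs = n" for \<alpha> \<nu> xs
    by (rule computes.Comp[of _ _ _ "map (\<lambda>g. g \<alpha> \<nu> xs) gs"])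
      (use that h p in \<open>auto simp: list_all2_conv_all_nth\<close>)
  then show ?thesis unfolding computable_def by blast
qed

lemma computable_compose:
  assumes "computable S (length gs) F" "\<And>g. g \<in> set gs \<Longrightarrow> computable S n g"
  shows "computable S n (\<lambda>\<alpha> \<nu> xs. F \<alpha> \<nu> (map (\<lambda>g. g \<alpha> \<nu> xs) gs))"
proof -
  obtain p where p: "\<And>\<alpha> \<nu> xs. \<alpha> \<in> S \<Longrightarrow> length xs = length gs \<Longrightarrow> computes [\<alpha>, \<nu>] p xs (F \<alpha> \<nu> xs)"
    using assms(1) by (rule computableE) blast
  show ?thesis
  proof (rule computable_Comp[where p = p and gs = gs])
    fix \<alpha> :: cantor and \<nu> :: cantor and xs :: "nat list"
    assume "\<alpha> \<in> S"
    then show "computes [\<alpha>, \<nu>] p (map (\<lambda>g. g \<alpha> \<nu> xs) gs) (F \<alpha> \<nu> (map (\<lambda>g. g \<alpha> \<nu> xs) gs))"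
      by (rule p) simp
  qed (rule assms(2))
qed

lemma computable_compose1:
  assumes "computable S 1 F" "computable S n f"
  shows "computable S n (\<lambda>\<alpha> \<nu> xs. F \<alpha> \<nu> [f \<alpha> \<nu> xs])"
  using computable_compose[of S "[f]" F n] assms by simp

lemma computable_nth [computable_intros]: "i < n \<Longrightarrow> computable S n (\<lambda>\<alpha> \<nu> xs. xs ! i)"
  unfolding computable_def by (metis computes.Proj)

lemma computable_Cons:
  assumes F: "computable S (Suc n) F" and f: "computable S n f"
  shows "computable S n (\<lambda>\<alpha> \<nu> xs. F \<alpha> \<nu> (f \<alpha> \<nu> xs # xs))"
proof (rule computable_cong)
  let ?gs = "f # map (\<lambda>i \<alpha> \<nu> xs. xs ! i) [0..<n]"
  show "computable S n (\<lambda>\<alpha> \<nu> xs. F \<alpha> \<nu> (map (\<lambda>g. g \<alpha> \<nu> xs) ?gs))"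
    by (rule computable_compose) (use F in \<open>auto intro!: computable_nth f\<close>)
  fix \<alpha> :: cantor and \<nu> :: cantor and xs :: "nat list"
  assume "length xs = n"
  then show "F \<alpha> \<nu> (map (\<lambda>g. g \<alpha> \<nu> xs) ?gs) = F \<alpha> \<nu> (f \<alpha> \<nu> xs # xs)"
    using map_nth[of xs] by (simp add: o_def)
qed

text \<open>In an approximation of a sum the arguments arrive as index, precision, parameters, while
  the summand expects a new precision first and the index second. This is that
  rearrangement.\<close>

lemma computable_replace_second:
  assumes F: "computable S (Suc (Suc n)) F" and h: "computable S (Suc (Suc n)) h"
  shows "computable S (Suc (Suc n)) (\<lambda>\<alpha> \<nu> xs. F \<alpha> \<nu> (h \<alpha> \<nu> xs # hd xs # tl (tl xs)))"
proof (rule computable_cong)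
  let ?gs = "h # (\<lambda>\<alpha> \<nu> xs. xs ! 0) # map (\<lambda>i \<alpha> \<nu> xs. xs ! Suc (Suc i)) [0..<n]"
  show "computable S (Suc (Suc n)) (\<lambda>\<alpha> \<nu> xs. F \<alpha> \<nu> (map (\<lambda>g. g \<alpha> \<nu> xs) ?gs))"
    by (rule computable_compose) (use F h in \<open>auto intro!: computable_nth\<close>)
  fix \<alpha> :: cantor and \<nu> :: cantor and xs :: "nat list"
  assume "length xs = Suc (Suc n)"
  then obtain x y zs where xs: "xs = x # y # zs" "length zs = n"
    by (auto simp: length_Suc_conv)
  then have "map (\<lambda>g. g \<alpha> \<nu> xs) ?gs = h \<alpha> \<nu> xs # hd xs # tl (tl xs)"
    using map_nth[of zs] by (simp add: o_def)
  then show "F \<alpha> \<nu> (map (\<lambda>g. g \<alpha> \<nu> xs) ?gs) = F \<alpha> \<nu> (h \<alpha> \<nu> xs # hd xs # tl (tl xs))"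
    by (rule arg_cong)
qed

lemma computable_tl:
  assumes F: "computable S n F"
  shows "computable S (Suc n) (\<lambda>\<alpha> \<nu> xs. F \<alpha> \<nu> (tl xs))"
proof (rule computable_cong)
  let ?gs = "map (\<lambda>i \<alpha> \<nu> xs. xs ! Suc i) [0..<n]"
  show "computable S (Suc n) (\<lambda>\<alpha> \<nu> xs. F \<alpha> \<nu> (map (\<lambda>g. g \<alpha> \<nu> xs) ?gs))"
    by (rule computable_compose) (use F in \<open>auto intro!: computable_nth\<close>)
  fix \<alpha> :: cantor and \<nu> :: cantor and xs :: "nat list"
  assume "length xs = Suc n"
  then obtain x zs where xs: "xs = x # zs" "length zs = n"
    by (auto simp: length_Suc_conv)
  then have "map (\<lambda>g. g \<alpha> \<nu> xs) ?gs = tl xs"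
    using map_nth[of zs] by (simp add: o_def)
  then show "F \<alpha> \<nu> (map (\<lambda>g. g \<alpha> \<nu> xs) ?gs) = F \<alpha> \<nu> (tl xs)"
    by (rule arg_cong)
qed

text \<open>Hides the accumulator of a recursion from the step function. Followed by
  \<open>computable_Cons\<close> it overwrites the head argument, for instance by a higher
  precision.\<close>

lemma computable_skip:
  assumes F: "computable S (Suc n) F"
  shows "computable S (Suc (Suc n)) (\<lambda>\<alpha> \<nu> xs. F \<alpha> \<nu> (hd xs # tl (tl xs)))"
  using computable_replace_second[OF computable_tl[OF F] computable_nth[of 0]] by simp

lemma computable_hd: "computable S (Suc n) (\<lambda>\<alpha> \<nu> xs. hd xs)"
  by (rule computable_cong[OF computable_nth[of 0]]) (auto simp: length_Suc_conv)

lemma computable_Suc [computable_intros]: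
  assumes "computable S n f"
  shows "computable S n (\<lambda>\<alpha> \<nu> xs. Suc (f \<alpha> \<nu> xs))"
proof -
  have "\<forall>\<alpha>\<in>S. \<forall>\<nu> xs. length xs = 1 \<longrightarrow> computes [\<alpha>, \<nu>] Succ xs (Suc (xs ! 0))"
    by (auto simp: length_Suc_conv intro: computes.Succ)
  then have "computable S 1 (\<lambda>\<alpha> \<nu> xs. Suc (xs ! 0))"
    unfolding computable_def by blast
  from computable_compose1[OF this assms] show ?thesis by simp
qed

lemma computable_const [computable_intros]: "computable S n (\<lambda>\<alpha> \<nu> xs. k)"
proof (induction k)
  case 0
  show ?case unfolding computable_def by (metis computes.Zero)
qed (rule computable_Suc)

lemma computable_oracle1 [computable_intros]:
  assumes "computable S n f"
  shows "computable S n (\<lambda>\<alpha> \<nu> xs. of_bool (\<alpha> (f \<alpha> \<nu> xs)))"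
proof -
  have "computes [\<alpha>, \<nu>] (Oracle 0) xs (of_bool (\<alpha> (xs ! 0)))"
    if "length xs = 1" for \<alpha> \<nu> :: cantor and xs
    using that computes.Oracle[of 0 "[\<alpha>, \<nu>]" "xs ! 0"] by (cases xs) simp_all
  then have "computable S 1 (\<lambda>\<alpha> \<nu> xs. of_bool (\<alpha> (xs ! 0)))"
    unfolding computable_def by blast
  from computable_compose1[OF this assms] show ?thesis by simp
qed

lemma computable_oracle2 [computable_intros]:
  assumes "computable S n f"
  shows "computable S n (\<lambda>\<alpha> \<nu> xs. of_bool (\<nu> (f \<alpha> \<nu> xs)))"
proof -
  have "computes [\<alpha>, \<nu>] (Oracle 1) xs (of_bool (\<nu> (xs ! 0)))"
    if "length xs = 1" for \<alpha> \<nu> :: cantor and xs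
    using that computes.Oracle[of 1 "[\<alpha>, \<nu>]" "xs ! 0"] by (cases xs) simp_all
  then have "computable S 1 (\<lambda>\<alpha> \<nu> xs. of_bool (\<nu> (xs ! 0)))"
    unfolding computable_def by blast
  from computable_compose1[OF this assms] show ?thesis by simp
qed

lemma computable_rec:
  assumes f: "computable S n f" and g: "computable S (Suc (Suc n)) g" and b: "computable S n b"
  shows "computable S n (\<lambda>\<alpha> \<nu> xs. rec_nat (f \<alpha> \<nu> xs) (\<lambda>m y. g \<alpha> \<nu> (m # y # xs)) (b \<alpha> \<nu> xs))"
proof -
  obtain p where p: "\<And>\<alpha> \<nu> xs. \<alpha> \<in> S \<Longrightarrow> length xs = n \<Longrightarrow> computes [\<alpha>, \<nu>] p xs (f \<alpha> \<nu> xs)"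
    using f by (rule computableE) blast
  obtain q where q: "\<And>\<alpha> \<nu> xs. \<alpha> \<in> S \<Longrightarrow> length xs = Suc (Suc n) \<Longrightarrow> computes [\<alpha>, \<nu>] q xs (g \<alpha> \<nu> xs)"
    using g by (rule computableE) blast
  have *: "computes [\<alpha>, \<nu>] (PrimRec p q) (k # xs) (rec_nat (f \<alpha> \<nu> xs) (\<lambda>m y. g \<alpha> \<nu> (m # y # xs)) k)"
    if "\<alpha> \<in> S" "length xs = n" for \<alpha> \<nu> xs k
    by (induction k) (use that in \<open>auto intro!: computes.PrimRec_0 p computes.PrimRec_Suc q\<close>)
  have "computable S (Suc n)
      (\<lambda>\<alpha> \<nu> ys. rec_nat (f \<alpha> \<nu> (tl ys)) (\<lambda>m y. g \<alpha> \<nu> (m # y # tl ys)) (hd ys))"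
    unfolding computable_def
    by (intro exI[of _ "PrimRec p q"]) (auto simp: length_Suc_conv intro: *)
  from computable_Cons[OF this b] show ?thesis by simp
qed

lemma computable_Least:
  assumes F: "computable S (Suc n) F"
    and ex: "\<And>\<alpha> \<nu> xs. \<alpha> \<in> S \<Longrightarrow> length xs = n \<Longrightarrow> \<exists>k. F \<alpha> \<nu> (k # xs) = 0"
  shows "computable S n (\<lambda>\<alpha> \<nu> xs. LEAST k. F \<alpha> \<nu> (k # xs) = 0)"
proof -
  obtain p where p: "\<And>\<alpha> \<nu> xs. \<alpha> \<in> S \<Longrightarrow> length xs = Suc n \<Longrightarrow> computes [\<alpha>, \<nu>] p xs (F \<alpha> \<nu> xs)"
    using F by (rule computableE) blast
  have "computes [\<alpha>, \<nu>] (Mu p) xs (LEAST k. F \<alpha> \<nu> (k # xs) = 0)"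
    if "\<alpha> \<in> S" "length xs = n" for \<alpha> \<nu> xs
  proof (rule computes.Mu)
    have "F \<alpha> \<nu> ((LEAST k. F \<alpha> \<nu> (k # xs) = 0) # xs) = 0"
      using ex[OF that] by (rule LeastI_ex)
    then show "computes [\<alpha>, \<nu>] p ((LEAST k. F \<alpha> \<nu> (k # xs) = 0) # xs) 0"
      using p[of \<alpha> "(LEAST k. F \<alpha> \<nu> (k # xs) = 0) # xs" \<nu>] that by simp
    fix m assume "m < (LEAST k. F \<alpha> \<nu> (k # xs) = 0)"
    then have "0 < F \<alpha> \<nu> (m # xs)"
      using not_less_Least by blast
    then show "\<exists>y>0. computes [\<alpha>, \<nu>] p (m # xs) y"
      using p[of \<alpha> "m # xs" \<nu>] that by auto
  qed
  then show ?thesis unfolding computable_def by blast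
qed

section \<open>Arithmetic on natural numbers\<close>

lemma computable_add [computable_intros]:
  assumes "computable S n f" "computable S n g"
  shows "computable S n (\<lambda>\<alpha> \<nu> xs. f \<alpha> \<nu> xs + g \<alpha> \<nu> xs)"
proof -
  have *: "rec_nat a (\<lambda>m y. Suc y) b = a + b" for a b :: nat
    by (induction b) auto
  show ?thesis
    using computable_rec[OF assms(1) _ assms(2), of "\<lambda>\<alpha> \<nu> ys. Suc (ys ! 1)"]
    by (simp add: computable_intros *)
qed

lemma computable_mult [computable_intros]:
  assumes "computable S n f" "computable S n g"
  shows "computable S n (\<lambda>\<alpha> \<nu> xs. f \<alpha> \<nu> xs * g \<alpha> \<nu> xs)"
proof -
  have *: "rec_nat 0 (\<lambda>m y. y + a) b = a * b" for a b :: nat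
    by (induction b) auto
  have "computable S (Suc (Suc n)) (\<lambda>\<alpha> \<nu> ys. ys ! 1 + f \<alpha> \<nu> (tl (tl ys)))"
    by (intro computable_intros computable_tl assms) auto
  from computable_rec[OF computable_const this assms(2), of 0] show ?thesis
    by (simp add: *)
qed

lemma computable_power [computable_intros]:
  assumes "computable S n f" "computable S n g"
  shows "computable S n (\<lambda>\<alpha> \<nu> xs. f \<alpha> \<nu> xs ^ g \<alpha> \<nu> xs)"
proof -
  have *: "rec_nat (Suc 0) (\<lambda>m y. y * a) b = a ^ b" for a b :: nat
    by (induction b) auto
  have "computable S (Suc (Suc n)) (\<lambda>\<alpha> \<nu> ys. ys ! 1 * f \<alpha> \<nu> (tl (tl ys)))"
    by (intro computable_intros computable_tl assms) auto
  from computable_rec[OF computable_const this assms(2), of 1] show ?thesis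
    by (simp add: *)
qed

lemma computable_diff [computable_intros]:
  assumes "computable S n f" "computable S n g"
  shows "computable S n (\<lambda>\<alpha> \<nu> xs. f \<alpha> \<nu> xs - g \<alpha> \<nu> xs)"
proof -
  have pred: "rec_nat 0 (\<lambda>m y. m) b = b - 1" for b :: nat
    by (cases b) auto
  have 1: "computable S 1 (\<lambda>\<alpha> \<nu> xs. xs ! 0 - 1)"
    using computable_rec[OF computable_const, of S 1 "\<lambda>\<alpha> \<nu> ys. ys ! 0" "\<lambda>\<alpha> \<nu> ys. ys ! 0" 0]
    by (simp add: computable_intros pred)
  have *: "rec_nat a (\<lambda>m y. y - Suc 0) b = a - b" for a b :: nat
    by (induction b) auto
  have "computable S (Suc (Suc n)) (\<lambda>\<alpha> \<nu> ys. ys ! 1 - 1)"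
    using computable_compose1[OF 1 computable_nth[of 1 "Suc (Suc n)"]] by simp
  from computable_rec[OF assms(1) this assms(2)] show ?thesis
    by (simp add: *)
qed

section \<open>Decidable relations as 0-1 valued functions\<close>

lemma computable_not [computable_intros]:
  assumes "computable S n (\<lambda>\<alpha> \<nu> xs. of_bool (P \<alpha> \<nu> xs))"
  shows "computable S n (\<lambda>\<alpha> \<nu> xs. of_bool (\<not> P \<alpha> \<nu> xs))"
  by (rule computable_cong[OF computable_diff[OF computable_const[of _ _ 1] assms]]) auto

lemma computable_conj [computable_intros]:
  assumes "computable S n (\<lambda>\<alpha> \<nu> xs. of_bool (P \<alpha> \<nu> xs))"
    and "computable S n (\<lambda>\<alpha> \<nu> xs. of_bool (Q \<alpha> \<nu> xs))"
  shows "computable S n (\<lambda>\<alpha> \<nu> xs. of_bool (P \<alpha> \<nu> xs \<and> Q \<alpha> \<nu> xs))"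
  by (rule computable_cong[OF computable_mult[OF assms]]) auto

lemma computable_imp [computable_intros]:
  assumes "computable S n (\<lambda>\<alpha> \<nu> xs. of_bool (P \<alpha> \<nu> xs))"
    and "computable S n (\<lambda>\<alpha> \<nu> xs. of_bool (Q \<alpha> \<nu> xs))"
  shows "computable S n (\<lambda>\<alpha> \<nu> xs. of_bool (P \<alpha> \<nu> xs \<longrightarrow> Q \<alpha> \<nu> xs))"
  by (rule computable_cong[OF computable_not[OF computable_conj[OF assms(1) computable_not[OF assms(2)]]]]) auto

lemma computable_le [computable_intros]:
  assumes "computable S n f" "computable S n g"
  shows "computable S n (\<lambda>\<alpha> \<nu> xs. of_bool (f \<alpha> \<nu> xs \<le> g \<alpha> \<nu> xs))"
  by (rule computable_cong[OF computable_diff[OF computable_const[of _ _ 1] computable_diff[OF assms]]]) auto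

lemma computable_less [computable_intros]:
  assumes "computable S n f" "computable S n g"
  shows "computable S n (\<lambda>\<alpha> \<nu> xs. of_bool (f \<alpha> \<nu> xs < g \<alpha> \<nu> xs))"
  by (rule computable_cong[OF computable_not[OF computable_le[OF assms(2,1)]]]) auto

lemma computable_eq [computable_intros]:
  assumes "computable S n f" "computable S n g"
  shows "computable S n (\<lambda>\<alpha> \<nu> xs. of_bool (f \<alpha> \<nu> xs = g \<alpha> \<nu> xs))"
  by (rule computable_cong[OF computable_conj[OF computable_le[OF assms] computable_le[OF assms(2,1)]]]) auto

lemma computable_if [computable_intros]:
  assumes P: "computable S n (\<lambda>\<alpha> \<nu> xs. of_bool (P \<alpha> \<nu> xs))"
    and f: "computable S n f" and g: "computable S n g"
  shows "computable S n (\<lambda>\<alpha> \<nu> xs. if P \<alpha> \<nu> xs then f \<alpha> \<nu> xs else g \<alpha> \<nu> xs)"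
  by (rule computable_cong[OF computable_add[OF computable_mult[OF P f]
          computable_mult[OF computable_not[OF P] g]]]) auto

lemma computable_if_bool [computable_intros]:
  assumes P: "computable S n (\<lambda>\<alpha> \<nu> xs. of_bool (P \<alpha> \<nu> xs))"
    and f: "computable S n (\<lambda>\<alpha> \<nu> xs. of_bool (Q \<alpha> \<nu> xs))"
    and g: "computable S n (\<lambda>\<alpha> \<nu> xs. of_bool (R \<alpha> \<nu> xs))"
  shows "computable S n (\<lambda>\<alpha> \<nu> xs. of_bool (if P \<alpha> \<nu> xs then Q \<alpha> \<nu> xs else R \<alpha> \<nu> xs))"
  by (rule computable_cong[OF computable_if[OF P f g]]) auto

lemma computable_min [computable_intros]:
  assumes "computable S n f" "computable S n g"
  shows "computable S n (\<lambda>\<alpha> \<nu> xs. min (f \<alpha> \<nu> xs) (g \<alpha> \<nu> xs))"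
  unfolding min_def by (intro computable_intros assms)

lemma computable_max [computable_intros]:
  assumes "computable S n f" "computable S n g"
  shows "computable S n (\<lambda>\<alpha> \<nu> xs. max (f \<alpha> \<nu> xs) (g \<alpha> \<nu> xs))"
  unfolding max_def by (intro computable_intros assms)

lemma computable_sum:
  assumes F: "computable S (Suc n) F" and b: "computable S n b"
  shows "computable S n (\<lambda>\<alpha> \<nu> xs. \<Sum>j<b \<alpha> \<nu> xs. F \<alpha> \<nu> (j # xs))"
proof -
  have *: "rec_nat 0 (\<lambda>m y. y + h m) k = (\<Sum>j<k. h j)" for h :: "nat \<Rightarrow> nat" and k
    by (induction k) auto
  have "computable S (Suc (Suc n)) (\<lambda>\<alpha> \<nu> ys. ys ! 1 + F \<alpha> \<nu> (hd ys # tl (tl ys)))"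
    by (intro computable_intros computable_skip F) auto
  from computable_rec[OF computable_const this b, of 0] show ?thesis
    by (simp add: *)
qed

lemma computable_div [computable_intros]:
  assumes f: "computable S n f" and g: "computable S n g"
  shows "computable S n (\<lambda>\<alpha> \<nu> xs. f \<alpha> \<nu> xs div g \<alpha> \<nu> xs)"
proof (rule computable_cong)
  \<comment> \<open>The quotient counts the q with (q + 1) * g \<le> f. For g = 0 the count would be
    f, whereas division by 0 yields 0 in HOL; hence the separate case.\<close>
  let ?d = "\<lambda>\<alpha> \<nu> xs. (\<Sum>q<f \<alpha> \<nu> xs. of_bool (Suc q * g \<alpha> \<nu> xs \<le> f \<alpha> \<nu> xs))"
  have F: "computable S (Suc n)
      (\<lambda>\<alpha> \<nu> ys. of_bool (Suc (hd ys) * g \<alpha> \<nu> (tl ys) \<le> f \<alpha> \<nu> (tl ys)))"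
    by (intro computable_intros computable_hd computable_tl f g)
  have "computable S n ?d"
    using computable_sum[OF F f] by simp
  then show "computable S n (\<lambda>\<alpha> \<nu> xs. if g \<alpha> \<nu> xs = 0 then 0 else ?d \<alpha> \<nu> xs)"
    by (intro computable_intros g)
  fix \<alpha> \<nu> xs
  have "(\<Sum>q<a. of_bool (Suc q * d \<le> a)) = a div d" if "d > 0" for a d :: nat
  proof -
    have "Suc q * d \<le> a \<longleftrightarrow> q < a div d" for q
      using less_eq_div_iff_mult_less_eq[OF that, of "Suc q" a] by (simp add: Suc_le_eq)
    moreover have "a div d \<le> a"
      by (rule div_le_dividend)
    ultimately have "{q. q < a \<and> Suc q * d \<le> a} = {..<a div d}"
      using less_le_trans by blast
    then have "card {q. q < a \<and> Suc q * d \<le> a} = a div d" by simp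
    moreover have "{..<a} \<inter> {q. Suc q * d \<le> a} = {q. q < a \<and> Suc q * d \<le> a}" by auto
    ultimately show ?thesis by (simp add: sum.If_cases of_bool_def)
  qed
  then show "(if g \<alpha> \<nu> xs = 0 then 0 else ?d \<alpha> \<nu> xs) = f \<alpha> \<nu> xs div g \<alpha> \<nu> xs"
    by auto
qed

lemma computable_mod [computable_intros]:
  assumes f: "computable S n f" and g: "computable S n g"
  shows "computable S n (\<lambda>\<alpha> \<nu> xs. f \<alpha> \<nu> xs mod g \<alpha> \<nu> xs)"
  by (rule computable_cong[OF computable_diff[OF f computable_mult[OF computable_div[OF f g] g]]])
    (simp add: minus_div_mult_eq_mod)

section \<open>Kleene normal form\<close>

text \<open>A value \<open>Suc y\<close> means that the computation halts with output \<open>y\<close> when all unbounded searches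
  are cut off at \<open>c\<close>; the value 0 means that it does not.\<close>

fun fuel :: "cantor list \<Rightarrow> prog \<Rightarrow> nat \<Rightarrow> nat list \<Rightarrow> nat" where
  "fuel As Zero c xs = 1"
| "fuel As Succ c xs = (if length xs = 1 then Suc (Suc (xs ! 0)) else 0)"
| "fuel As (Proj i) c xs = (if i < length xs then Suc (xs ! i) else 0)"
| "fuel As (Oracle i) c xs =
     (if i < length As \<and> length xs = 1 then Suc (of_bool ((As ! i) (xs ! 0))) else 0)"
| "fuel As (Comp f gs) c xs =
     (if \<forall>g\<in>set gs. fuel As g c xs \<noteq> 0 then fuel As f c (map (\<lambda>g. fuel As g c xs - 1) gs) else 0)"
| "fuel As (PrimRec f g) c xs =
     (if xs = [] then 0 else
        rec_nat (fuel As f c (tl xs))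
          (\<lambda>m y. if y = 0 then 0 else fuel As g c (m # (y - 1) # tl xs)) (hd xs))"
| "fuel As (Mu f) c xs =
     (let n = (LEAST n. n = c \<or> fuel As f c (n # xs) \<le> 1)
      in if fuel As f c (n # xs) = 1 then Suc n else 0)"

lemma fuel_sound: "fuel As p c xs = Suc y \<Longrightarrow> computes As p xs y"
proof (induction p arbitrary: xs y)
  case (Comp f gs)
  then have nz: "\<forall>g\<in>set gs. fuel As g c xs \<noteq> 0"
    and f: "fuel As f c (map (\<lambda>g. fuel As g c xs - 1) gs) = Suc y"
    by (auto split: if_splits)
  have "list_all2 (\<lambda>g y. computes As g xs y) gs (map (\<lambda>g. fuel As g c xs - 1) gs)"
    using nz Comp.IH(2) by (auto simp: list_all2_conv_all_nth)
  then show ?case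
    using Comp.IH(1)[OF f] by (rule computes.Comp)
next
  case (PrimRec f g)
  then obtain n zs where xs: "xs = n # zs"
    by (cases xs) auto
  have "rec_nat (fuel As f c zs) (\<lambda>m y. if y = 0 then 0 else fuel As g c (m # (y - 1) # zs)) n = Suc y
      \<Longrightarrow> computes As (PrimRec f g) (n # zs) y"
  proof (induction n arbitrary: y)
    case 0
    then show ?case
      by (auto intro: computes.PrimRec_0 PrimRec.IH(1))
  next
    case (Suc n)
    then obtain z where "rec_nat (fuel As f c zs)
        (\<lambda>m y. if y = 0 then 0 else fuel As g c (m # (y - 1) # zs)) n = Suc z"
      and "fuel As g c (n # z # zs) = Suc y"
      by (auto split: if_splits simp: gr0_conv_Suc)
    then show ?case
      using Suc.IH PrimRec.IH(2) by (blast intro: computes.PrimRec_Suc)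
  qed
  then show ?case
    using PrimRec.prems unfolding xs fuel.simps list.sel by simp
next
  case (Mu f)
  \<comment> \<open>The bounded search stops at the first zero (value 1), at the first unfinished
    computation (value 0) or at c. Only value 1 is accepted there, and then all earlier values are
    at least 2, which means positive outputs.\<close>
  define n where "n = (LEAST n. n = c \<or> fuel As f c (n # xs) \<le> 1)"
  have n: "fuel As f c (n # xs) = 1" and y: "y = n"
    using Mu.prems by (auto simp: n_def Let_def split: if_splits)
  have "\<exists>y>0. computes As f (m # xs) y" if "m < n" for m
  proof -
    have "\<not> fuel As f c (m # xs) \<le> 1"
      using not_less_Least[of m "\<lambda>n. n = c \<or> fuel As f c (n # xs) \<le> 1"] that
      unfolding n_def by blast
    then have "fuel As f c (m # xs) = Suc (fuel As f c (m # xs) - 1)" "fuel As f c (m # xs) - 1 > 0"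
      by auto
    then show ?thesis
      using Mu.IH by blast
  qed
  then show ?case
    using n Mu.IH unfolding y by (intro computes.Mu) auto
qed (auto split: if_splits intro: computes.intros simp: length_Suc_conv)

text \<open>Finitely many subcomputations need a common bound. The eventual quantifier is closed
  under finite conjunctions and so takes the place of monotonicity of \<open>fuel\<close> in the
  bound.\<close>

lemma fuel_complete: "computes As p xs y \<Longrightarrow> \<forall>\<^sub>F c in sequentially. fuel As p c xs = Suc y"
proof (induction rule: computes.induct)
  case (Comp xs gs ys f z)
  have "\<forall>\<^sub>F c in sequentially. \<forall>i\<in>{..<length gs}. fuel As (gs ! i) c xs = Suc (ys ! i)"
    using Comp.IH(1) by (intro eventually_ball_finite) (auto simp: list_all2_conv_all_nth)
  with Comp.IH(2) show ?case
  proof eventually_elim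
    case (elim c)
    have len: "length ys = length gs"
      using Comp.IH(1) by (simp add: list_all2_lengthD)
    have "map (\<lambda>g. fuel As g c xs - 1) gs = ys"
      using elim len by (intro nth_equalityI) auto
    moreover have "\<forall>g\<in>set gs. fuel As g c xs \<noteq> 0"
      using elim by (auto simp: in_set_conv_nth)
    ultimately show ?case
      using elim by simp
  qed
next
  case (PrimRec_Suc f g n xs y z)
  from PrimRec_Suc.IH show ?case
    unfolding fuel.simps list.sel by eventually_elim simp
next
  case (Mu f n xs)
  then obtain h where h: "\<And>m. m < n \<Longrightarrow> h m > 0 \<and> (\<forall>\<^sub>F c in sequentially. fuel As f c (m # xs) = Suc (h m))"
    by metis
  have "\<forall>\<^sub>F c in sequentially. \<forall>m\<in>{..<n}. fuel As f c (m # xs) = Suc (h m)"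
    using h by (intro eventually_ball_finite) auto
  \<comment> \<open>A bound c \<ge> n keeps the cut-off from ending the search before its true
    result.\<close>
  with Mu.IH(1) eventually_ge_at_top[of n] show ?case
  proof eventually_elim
    case (elim c)
    have "(LEAST n. n = c \<or> fuel As f c (n # xs) \<le> 1) = n"
    proof (rule Least_equality)
      show "n = c \<or> fuel As f c (n # xs) \<le> 1"
        using elim by simp
      fix m assume m: "m = c \<or> fuel As f c (m # xs) \<le> 1"
      show "n \<le> m"
      proof (rule ccontr)
        assume "\<not> n \<le> m"
        then show False
          using m elim h[of m] by auto
      qed
    qed
    then show ?case
      using elim by simp
  qed
qed auto

lemma computes_iff_fuel: "computes As p xs y \<longleftrightarrow> (\<exists>c. fuel As p c xs = Suc y)"
  using fuel_sound fuel_complete[THEN eventually_happens] by (auto simp: trivial_limit_sequentially)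

text \<open>Both outputs are values of the function \<open>fuel\<close> at one common bound.\<close>

lemma computes_deterministic:
  assumes "computes As p xs y" "computes As p xs z"
  shows "y = z"
proof -
  have "\<forall>\<^sub>F c in sequentially. fuel As p c xs = Suc y \<and> fuel As p c xs = Suc z"
    using assms by (intro eventually_conj fuel_complete)
  then show ?thesis
    by (auto dest: eventually_happens)
qed

lemma computable_ball_nonzero:
  assumes "\<And>g. g \<in> set gs \<Longrightarrow> computable S n (h g)"
  shows "computable S n (\<lambda>\<alpha> \<nu> xs. of_bool (\<forall>g\<in>set gs. h g \<alpha> \<nu> xs \<noteq> 0))"
  using assms
proof (induction gs)
  case Nil
  show ?case by (simp add: computable_const)
next
  case (Cons g gs)
  then have "computable S n (\<lambda>\<alpha> \<nu> xs. of_bool (\<not> h g \<alpha> \<nu> xs = 0 \<and> (\<forall>g\<in>set gs. h g \<alpha> \<nu> xs \<noteq> 0)))"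
    by (intro computable_intros) auto
  then show ?case by simp
qed

text \<open>\<open>take k\<close> selects how many of the two oracles the simulated program may use.\<close>

lemma computable_fuel:
  "computable S (Suc n) (\<lambda>\<alpha> \<nu> ys. fuel (take k [\<alpha>, \<nu>]) p (hd ys) (tl ys))"
proof (induction p arbitrary: n)
  case Zero
  show ?case by (simp add: computable_const[of S "Suc n" "Suc 0"])
next
  case Succ
  \<comment> \<open>The arity is fixed, so the length tests of \<open>fuel\<close> are settled
    outside the program, by a case distinction on \<open>n\<close>.\<close>
  have "computable S (Suc n) (\<lambda>\<alpha> \<nu> ys. if n = 1 then Suc (Suc (ys ! 1)) else 0)"
    by (cases "n = 1") (auto intro!: computable_intros)
  then show ?case
    by (rule computable_cong) (auto simp: length_Suc_conv)
next
  case (Proj i)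
  have "computable S (Suc n) (\<lambda>\<alpha> \<nu> ys. if i < n then Suc (ys ! Suc i) else 0)"
    by (cases "i < n") (auto intro!: computable_intros)
  then show ?case
    by (rule computable_cong) (auto simp: length_Suc_conv)
next
  case (Oracle i)
  consider "i < k" "n = 1" "i = 0" | "i < k" "n = 1" "i = 1" | "i \<ge> k \<or> n \<noteq> 1 \<or> i \<ge> 2"
    by linarith
  then show ?case
  proof cases
    case 1
    have "computable S (Suc n) (\<lambda>\<alpha> \<nu> ys. Suc (of_bool (\<alpha> (ys ! 1))))"
      using 1 by (intro computable_intros) auto
    then show ?thesis
      by (rule computable_cong) (use 1 in \<open>auto simp: length_Suc_conv\<close>)
  next
    case 2
    have "computable S (Suc n) (\<lambda>\<alpha> \<nu> ys. Suc (of_bool (\<nu> (ys ! 1))))"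
      using 2 by (intro computable_intros) auto
    then show ?thesis
      by (rule computable_cong) (use 2 in \<open>auto simp: length_Suc_conv\<close>)
  next
    case 3
    show ?thesis
      by (rule computable_cong[OF computable_const[of _ _ 0]]) (use 3 in auto)
  qed
next
  case (Comp f gs)
  let ?F = "\<lambda>p \<alpha> \<nu> ys. fuel (take k [\<alpha>, \<nu>]) p (hd ys) (tl ys)"
  let ?gs = "(\<lambda>\<alpha> \<nu> ys. hd ys) # map (\<lambda>g \<alpha> \<nu> ys. ?F g \<alpha> \<nu> ys - 1) gs"
  have "computable S (Suc n) (\<lambda>\<alpha> \<nu> ys. ?F f \<alpha> \<nu> (map (\<lambda>g. g \<alpha> \<nu> ys) ?gs))"
  proof (rule computable_compose)
    fix g assume "g \<in> set ?gs"
    then show "computable S (Suc n) g"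
      by (auto intro!: computable_hd computable_intros Comp.IH(2) simp del: One_nat_def)
  qed (simp add: Comp.IH(1))
  then have "computable S (Suc n) (\<lambda>\<alpha> \<nu> ys. if \<forall>g\<in>set gs. ?F g \<alpha> \<nu> ys \<noteq> 0 then
      ?F f \<alpha> \<nu> (map (\<lambda>g. g \<alpha> \<nu> ys) ?gs) else 0)"
    by (intro computable_if computable_ball_nonzero Comp.IH(2) computable_const)
  then show ?case
    by (rule computable_cong) (auto simp: o_def)
next
  case (PrimRec f g)
  let ?F = "\<lambda>p \<alpha> \<nu> ys. fuel (take k [\<alpha>, \<nu>]) p (hd ys) (tl ys)"
  show ?case
  proof (cases n)
    case 0
    show ?thesis
      by (rule computable_cong[OF computable_const[of _ _ 0]]) (use 0 in \<open>auto simp: length_Suc_conv\<close>)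
  next
    case (Suc n')
    let ?f = "\<lambda>\<alpha> \<nu> ys. ?F f \<alpha> \<nu> (hd ys # tl (tl ys))"
    \<comment> \<open>The arguments are the counter, the accumulator, the bound, the recursion
      argument and the parameters. The simulated step gets the bound first, then the counter and the
      accumulator minus 1, since the accumulator stores the successor of the output; the recursion
      argument at position 3 is skipped.\<close>
    let ?g0 = "\<lambda>\<alpha> \<nu> zs. ?F g \<alpha> \<nu> (map (\<lambda>g. g \<alpha> \<nu> zs)
        ((\<lambda>\<alpha> \<nu> zs. zs ! 2) # (\<lambda>\<alpha> \<nu> zs. zs ! 0) # (\<lambda>\<alpha> \<nu> zs. zs ! 1 - 1) #
          map (\<lambda>i \<alpha> \<nu> zs. zs ! (i + 4)) [0..<n']))"
    have f: "computable S (Suc n) ?f"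
      unfolding Suc by (rule computable_skip) (rule PrimRec.IH)
    have "computable S (Suc (Suc (Suc n))) ?g0"
      by (rule computable_compose)
        (auto intro!: computable_intros PrimRec.IH(2) simp: Suc simp del: One_nat_def)
    then have g: "computable S (Suc (Suc (Suc n))) (\<lambda>\<alpha> \<nu> zs. if zs ! 1 = 0 then 0 else ?g0 \<alpha> \<nu> zs)"
      by (intro computable_intros) auto
    have map_eq: "map (\<lambda>i. (m # y # c # x # zs) ! (i + 4)) [0..<n'] = zs" if "length zs = n'" for m y c x zs
      using that map_nth[of zs] by simp
    have "computable S (Suc n) (\<lambda>\<alpha> \<nu> ys. rec_nat (?f \<alpha> \<nu> ys)
        (\<lambda>m y. if (m # y # ys) ! 1 = 0 then 0 else ?g0 \<alpha> \<nu> (m # y # ys)) (ys ! 1))"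
      using computable_rec[OF f g computable_nth[of 1 "Suc n"]] Suc by simp
    then show ?thesis
    proof (rule computable_cong)
      fix \<alpha> \<nu> :: cantor and ys :: "nat list" assume "length ys = Suc n"
      then obtain c x zs where ys: "ys = c # x # zs" "length zs = n'"
        using Suc by (auto simp: length_Suc_conv)
      have step: "(\<lambda>m y. if (m # y # ys) ! 1 = 0 then 0 else ?g0 \<alpha> \<nu> (m # y # ys)) =
          (\<lambda>m y. if y = 0 then 0 else fuel (take k [\<alpha>, \<nu>]) g c (m # (y - 1) # zs))"
        unfolding ys using map_eq[OF ys(2)] by (intro ext) (simp add: o_def)
      show "rec_nat (?f \<alpha> \<nu> ys) (\<lambda>m y. if (m # y # ys) ! 1 = 0 then 0 else ?g0 \<alpha> \<nu> (m # y # ys)) (ys ! 1)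
          = ?F (PrimRec f g) \<alpha> \<nu> ys"
        unfolding step unfolding ys fuel.simps list.sel by simp
    qed
  qed
next
  case (Mu f)
  let ?F = "\<lambda>p \<alpha> \<nu> ys. fuel (take k [\<alpha>, \<nu>]) p (hd ys) (tl ys)"
  let ?swap = "map (\<lambda>g. g) ((\<lambda>\<alpha> \<nu> zs. zs ! 1) # (\<lambda>\<alpha> \<nu> zs. zs ! 0) # map (\<lambda>i \<alpha> \<nu> zs. zs ! (i + 2)) [0..<n])"
  let ?f = "\<lambda>\<alpha> \<nu> zs. ?F f \<alpha> \<nu> (map (\<lambda>g. g \<alpha> \<nu> zs) ?swap)"
  have f: "computable S (Suc (Suc n)) ?f"
    by (rule computable_compose) (auto intro!: computable_intros Mu.IH simp del: One_nat_def)
  have map_eq: "map (\<lambda>i. (m # c # zs) ! (i + 2)) [0..<n] = zs" if "length zs = n" for m c zs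
    using that map_nth[of zs] by simp
  \<comment> \<open>\<open>?t\<close> vanishes exactly where the search inside \<open>fuel\<close>
    stops. It does so at the latest at the bound, so the minimization is total.\<close>
  let ?t = "\<lambda>\<alpha> \<nu> zs. of_bool (\<not> zs ! 0 = zs ! 1 \<and> \<not> ?f \<alpha> \<nu> zs \<le> 1) :: nat"
  have t: "computable S (Suc (Suc n)) ?t"
    by (intro computable_intros f) auto
  let ?n = "\<lambda>\<alpha> \<nu> ys. LEAST m. ?t \<alpha> \<nu> (m # ys) = 0"
  have n: "computable S (Suc n) ?n"
  proof (rule computable_Least[OF t])
    fix \<alpha> \<nu> :: cantor and ys :: "nat list" assume "length ys = Suc n"
    show "\<exists>m. ?t \<alpha> \<nu> (m # ys) = 0"
      by (rule exI[of _ "ys ! 0"]) simp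
  qed
  have "computable S (Suc n) (\<lambda>\<alpha> \<nu> ys. if ?f \<alpha> \<nu> (?n \<alpha> \<nu> ys # ys) = 1 then Suc (?n \<alpha> \<nu> ys) else 0)"
    by (intro computable_if computable_eq computable_const computable_Suc n computable_Cons[OF f n])
  then show ?case
  proof (rule computable_cong)
    fix \<alpha> \<nu> :: cantor and ys :: "nat list" assume "length ys = Suc n"
    then obtain c zs where ys: "ys = c # zs" "length zs = n"
      by (auto simp: length_Suc_conv)
    have f_eq: "?f \<alpha> \<nu> (m # ys) = fuel (take k [\<alpha>, \<nu>]) f c (m # zs)" for m
      unfolding ys using map_eq[OF ys(2), of m c] by (simp add: o_def)
    have "?n \<alpha> \<nu> ys = (LEAST m. m = c \<or> fuel (take k [\<alpha>, \<nu>]) f c (m # zs) \<le> 1)"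
      unfolding f_eq by (rule arg_cong[of _ _ Least]) (auto simp: ys)
    then show "(if ?f \<alpha> \<nu> (?n \<alpha> \<nu> ys # ys) = 1 then Suc (?n \<alpha> \<nu> ys) else 0) = ?F (Mu f) \<alpha> \<nu> ys"
      unfolding f_eq by (simp add: ys Let_def)
  qed
qed

section \<open>Computable reals\<close>

text \<open>The numerator is a difference because functionals take natural values. The tolerance is
  2 units: one for the given approximation and one for rounding both parts down to the grid
  2^-k.\<close>

definition approximates ::
    "cantor set \<Rightarrow> nat \<Rightarrow> functional \<Rightarrow> functional \<Rightarrow> (cantor \<Rightarrow> cantor \<Rightarrow> nat list \<Rightarrow> real) \<Rightarrow> bool" where
  "approximates S n P N F \<longleftrightarrow> computable S (Suc n) P \<and> computable S (Suc n) N \<and>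
     (\<forall>\<alpha>\<in>S. \<forall>\<nu> k xs. length xs = n \<longrightarrow>
        \<bar>F \<alpha> \<nu> xs - (real (P \<alpha> \<nu> (k # xs)) - real (N \<alpha> \<nu> (k # xs))) / 2 ^ k\<bar> \<le> 2 / 2 ^ k)"

definition computable_real ::
    "cantor set \<Rightarrow> nat \<Rightarrow> (cantor \<Rightarrow> cantor \<Rightarrow> nat list \<Rightarrow> real) \<Rightarrow> bool" where
  "computable_real S n F \<longleftrightarrow> (\<exists>P N. approximates S n P N F)"

lemma approximatesD:
  assumes "approximates S n P N F"
  shows "computable S (Suc n) P" "computable S (Suc n) N"
    and "\<alpha> \<in> S \<Longrightarrow> length xs = n \<Longrightarrow>
      \<bar>F \<alpha> \<nu> xs - (real (P \<alpha> \<nu> (k # xs)) - real (N \<alpha> \<nu> (k # xs))) / 2 ^ k\<bar> \<le> 2 / 2 ^ k"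
  using assms unfolding approximates_def by auto

lemma real_div_bounds:
  assumes "d > 0"
  shows "real (a div d) \<le> real a / real d" "real a / real d < real (a div d) + 1"
proof -
  have "real (a div d) = of_int \<lfloor>real a / real d\<rfloor>"
    using floor_divide_of_nat_eq[of a d] by (metis of_int_of_nat_eq)
  then show "real (a div d) \<le> real a / real d" "real a / real d < real (a div d) + 1"
    by linarith+
qed

text \<open>Approximations with arbitrary denominators are rounded to the dyadic ones.\<close>

lemma computable_realI:
  assumes P: "computable S (Suc n) P" and N: "computable S (Suc n) N" and D: "computable S (Suc n) D"
    and approx: "\<And>\<alpha> \<nu> k xs. \<alpha> \<in> S \<Longrightarrow> length xs = n \<Longrightarrow> D \<alpha> \<nu> (k # xs) > 0 \<and>
      \<bar>F \<alpha> \<nu> xs - (real (P \<alpha> \<nu> (k # xs)) - real (N \<alpha> \<nu> (k # xs))) / real (D \<alpha> \<nu> (k # xs))\<bar> \<le> 1 / 2 ^ k"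
  shows "computable_real S n F"
  unfolding computable_real_def approximates_def
proof (intro exI conjI ballI allI impI)
  let ?r = "\<lambda>P \<alpha> \<nu> ys. (P \<alpha> \<nu> ys * 2 ^ (ys ! 0)) div D \<alpha> \<nu> ys"
  show "computable S (Suc n) (?r P)" "computable S (Suc n) (?r N)"
    by (intro computable_intros P N D; simp)+
  fix \<alpha> \<nu> k and xs :: "nat list"
  assume asm: "\<alpha> \<in> S" "length xs = n"
  define p where "p = P \<alpha> \<nu> (k # xs)"
  define q where "q = N \<alpha> \<nu> (k # xs)"
  define d where "d = D \<alpha> \<nu> (k # xs)"
  have d: "d > 0" and a: "\<bar>F \<alpha> \<nu> xs - (real p - real q) / real d\<bar> \<le> 1 / 2 ^ k"
    using approx[OF asm] unfolding p_def q_def d_def by auto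
  have "\<bar>(real p - real q) * 2 ^ k / d - (real (p * 2 ^ k div d) - real (q * 2 ^ k div d))\<bar> \<le> 1"
    using real_div_bounds[OF d, of "p * 2 ^ k"] real_div_bounds[OF d, of "q * 2 ^ k"]
    by (simp add: left_diff_distrib diff_divide_distrib)
  then have "\<bar>((real p - real q) * 2 ^ k / d - (real (p * 2 ^ k div d) - real (q * 2 ^ k div d))) / 2 ^ k\<bar> \<le> 1 / 2 ^ k"
    unfolding abs_divide by (simp add: divide_right_mono)
  moreover have "((real p - real q) * 2 ^ k / d - (real (p * 2 ^ k div d) - real (q * 2 ^ k div d))) / 2 ^ k =
      (real p - real q) / d - (real (p * 2 ^ k div d) - real (q * 2 ^ k div d)) / 2 ^ k"
    by (simp add: diff_divide_distrib)
  ultimately have "\<bar>(real p - real q) / d - (real (p * 2 ^ k div d) - real (q * 2 ^ k div d)) / 2 ^ k\<bar> \<le> 1 / 2 ^ k"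
    by simp
  with a show "\<bar>F \<alpha> \<nu> xs - (real (?r P \<alpha> \<nu> (k # xs)) - real (?r N \<alpha> \<nu> (k # xs))) / 2 ^ k\<bar> \<le> 2 / 2 ^ k"
    unfolding p_def[symmetric] q_def[symmetric] d_def[symmetric] nth_Cons_0 by linarith
qed

section \<open>Closure properties of computable reals\<close>

lemma computable_real_cong:
  assumes "computable_real S n F" "\<And>\<alpha> \<nu> xs. \<alpha> \<in> S \<Longrightarrow> length xs = n \<Longrightarrow> F \<alpha> \<nu> xs = G \<alpha> \<nu> xs"
  shows "computable_real S n G"
  using assms unfolding computable_real_def approximates_def by metis

lemma computable_real_ratio:
  assumes f: "computable S n f" and g: "computable S n g"
    and pos: "\<And>\<alpha> \<nu> xs. \<alpha> \<in> S \<Longrightarrow> length xs = n \<Longrightarrow> g \<alpha> \<nu> xs > 0"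
  shows "computable_real S n (\<lambda>\<alpha> \<nu> xs. real (f \<alpha> \<nu> xs) / real (g \<alpha> \<nu> xs))"
  by (rule computable_realI[OF computable_tl[OF f] computable_const[of S "Suc n" 0] computable_tl[OF g]])
    (simp add: pos)

lemma computable_real_add:
  assumes "computable_real S n F" "computable_real S n G"
  shows "computable_real S n (\<lambda>\<alpha> \<nu> xs. F \<alpha> \<nu> xs + G \<alpha> \<nu> xs)"
proof -
  obtain P N where a: "approximates S n P N F"
    using assms(1) unfolding computable_real_def by blast
  note PN = approximatesD(1,2)[OF a] and F = approximatesD(3)[OF a]
  obtain P' N' where a': "approximates S n P' N' G"
    using assms(2) unfolding computable_real_def by blast
  note PN' = approximatesD(1,2)[OF a'] and G = approximatesD(3)[OF a']
  \<comment> \<open>Precision k + 2, because two errors of 2 / 2^(k + 2) add up to 1 / 2^k.\<close>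
  let ?s = "\<lambda>P P' \<alpha> \<nu> ys. P \<alpha> \<nu> ((hd ys + 2) # tl ys) + P' \<alpha> \<nu> ((hd ys + 2) # tl ys)"
  have s: "computable S (Suc n) (\<lambda>\<alpha> \<nu> ys. P \<alpha> \<nu> ((hd ys + 2) # tl ys))" if "computable S (Suc n) P" for P
    using computable_Cons[OF computable_skip[OF that] computable_add[OF computable_hd computable_const[of _ _ 2]]]
    by simp
  show ?thesis
  proof (rule computable_realI)
    show "computable S (Suc n) (?s P P')" "computable S (Suc n) (?s N N')"
      by (intro computable_add s PN PN')+
    show "computable S (Suc n) (\<lambda>\<alpha> \<nu> ys. 2 ^ (hd ys + 2))"
      by (intro computable_intros computable_hd)
    fix \<alpha> \<nu> k and xs :: "nat list"
    assume asm: "\<alpha> \<in> S" "length xs = n"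
    have "(2::real) / 2 ^ (k + 2) + 2 / 2 ^ (k + 2) = 1 / 2 ^ k"
      by (simp add: field_simps)
    then show "2 ^ (hd (k # xs) + 2) > (0::nat) \<and>
      \<bar>F \<alpha> \<nu> xs + G \<alpha> \<nu> xs - (real (?s P P' \<alpha> \<nu> (k # xs)) - real (?s N N' \<alpha> \<nu> (k # xs))) /
        real (2 ^ (hd (k # xs) + 2))\<bar> \<le> 1 / 2 ^ k"
      using F[OF asm, of \<nu> "k + 2"] G[OF asm, of \<nu> "k + 2"]
      by (simp add: add_divide_distrib diff_divide_distrib del: power_Suc power_add)
  qed
qed

lemma computable_real_mult:
  assumes "computable_real S n F" "computable_real S n G"
  shows "computable_real S n (\<lambda>\<alpha> \<nu> xs. F \<alpha> \<nu> xs * G \<alpha> \<nu> xs)"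
proof -
  obtain P N where a: "approximates S n P N F"
    using assms(1) unfolding computable_real_def by blast
  note PN = approximatesD(1,2)[OF a] and F = approximatesD(3)[OF a]
  obtain P' N' where a': "approximates S n P' N' G"
    using assms(2) unfolding computable_real_def by blast
  note PN' = approximatesD(1,2)[OF a'] and G = approximatesD(3)[OF a']
  \<comment> \<open>The approximations at precision 0 bound each factor up to an error of 2, which
    accounts for 4. The other 2 lets c also bound |f| + |y| for an approximation f of the first
    factor. With K = k + 1 + c the error is at most 2 / 2^K * c, and c < 2^c.\<close>
  let ?c = "\<lambda>\<alpha> \<nu> xs. P \<alpha> \<nu> (0 # xs) + N \<alpha> \<nu> (0 # xs) + (P' \<alpha> \<nu> (0 # xs) + N' \<alpha> \<nu> (0 # xs)) + 6"
  let ?K = "\<lambda>\<alpha> \<nu> ys. hd ys + 1 + ?c \<alpha> \<nu> (tl ys)"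
  have c: "computable S n ?c"
    by (intro computable_add computable_Cons[OF PN(1) computable_const] computable_Cons[OF PN(2) computable_const]
      computable_Cons[OF PN'(1) computable_const] computable_Cons[OF PN'(2) computable_const] computable_const)
  have K: "computable S (Suc n) ?K"
    by (rule computable_add[OF computable_add[OF computable_hd computable_const] computable_tl[OF c]])
  have s: "computable S (Suc n) (\<lambda>\<alpha> \<nu> ys. P \<alpha> \<nu> (?K \<alpha> \<nu> ys # tl ys))" if "computable S (Suc n) P" for P
    using computable_Cons[OF computable_skip[OF that] K] by simp
  let ?s = "\<lambda>P \<alpha> \<nu> ys. P \<alpha> \<nu> (?K \<alpha> \<nu> ys # tl ys)"
  let ?m = "\<lambda>P P' N N' \<alpha> \<nu> ys. ?s P \<alpha> \<nu> ys * ?s P' \<alpha> \<nu> ys + ?s N \<alpha> \<nu> ys * ?s N' \<alpha> \<nu> ys"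
  show ?thesis
  proof (rule computable_realI)
    show "computable S (Suc n) (?m P P' N N')" "computable S (Suc n) (?m P N' N P')"
      by (intro computable_add computable_mult s PN PN')+
    show "computable S (Suc n) (\<lambda>\<alpha> \<nu> ys. 2 ^ ?K \<alpha> \<nu> ys * 2 ^ ?K \<alpha> \<nu> ys)"
      by (intro computable_mult computable_power K computable_const)
    fix \<alpha> \<nu> k and xs :: "nat list"
    assume asm: "\<alpha> \<in> S" "length xs = n"
    define c where "c = ?c \<alpha> \<nu> xs"
    define K where "K = k + 1 + c"
    define f where "f = (real (P \<alpha> \<nu> (K # xs)) - real (N \<alpha> \<nu> (K # xs))) / 2 ^ K"
    define g where "g = (real (P' \<alpha> \<nu> (K # xs)) - real (N' \<alpha> \<nu> (K # xs))) / 2 ^ K"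
    define x where "x = F \<alpha> \<nu> xs"
    define y where "y = G \<alpha> \<nu> xs"
    have xf: "\<bar>x - f\<bar> \<le> 2 / 2 ^ K" and yg: "\<bar>y - g\<bar> \<le> 2 / 2 ^ K"
      using F[OF asm, of \<nu> K] G[OF asm, of \<nu> K] unfolding f_def g_def x_def y_def by auto
    have "\<bar>x\<bar> + \<bar>y\<bar> + 2 \<le> real c"
      using F[OF asm, of \<nu> 0] G[OF asm, of \<nu> 0] unfolding c_def x_def y_def by simp
    moreover have "2 / 2 ^ K \<le> (2::real)"
      by (simp add: field_simps)
    ultimately have fy: "\<bar>f\<bar> + \<bar>y\<bar> \<le> real c"
      using xf by linarith
    have "x * y - f * g = (x - f) * y + f * (y - g)"
      by (simp add: algebra_simps)
    then have "\<bar>x * y - f * g\<bar> \<le> \<bar>x - f\<bar> * \<bar>y\<bar> + \<bar>f\<bar> * \<bar>y - g\<bar>"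
      using abs_triangle_ineq[of "(x - f) * y" "f * (y - g)"] by (simp add: abs_mult)
    also have "\<dots> \<le> 2 / 2 ^ K * \<bar>y\<bar> + \<bar>f\<bar> * (2 / 2 ^ K)"
      by (intro add_mono mult_mono xf yg) auto
    also have "\<dots> = 2 / 2 ^ K * (\<bar>f\<bar> + \<bar>y\<bar>)"
      by (simp add: algebra_simps add_divide_distrib)
    also have "\<dots> \<le> 2 / 2 ^ K * 2 ^ c"
      by (intro mult_left_mono order_trans[OF fy] less_imp_le of_nat_less_two_power) simp
    also have "\<dots> = 1 / 2 ^ k"
      by (simp add: K_def power_add)
    finally have "\<bar>x * y - f * g\<bar> \<le> 1 / 2 ^ k" .
    moreover have "(real (?m P P' N N' \<alpha> \<nu> (k # xs)) - real (?m P N' N P' \<alpha> \<nu> (k # xs))) /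
        real (2 ^ ?K \<alpha> \<nu> (k # xs) * 2 ^ ?K \<alpha> \<nu> (k # xs)) = f * g"
      unfolding list.sel c_def[symmetric] K_def[symmetric] f_def g_def
      by (simp add: field_simps)
    ultimately show "0 < (2::nat) ^ ?K \<alpha> \<nu> (k # xs) * 2 ^ ?K \<alpha> \<nu> (k # xs) \<and>
      \<bar>F \<alpha> \<nu> xs * G \<alpha> \<nu> xs - (real (?m P P' N N' \<alpha> \<nu> (k # xs)) - real (?m P N' N P' \<alpha> \<nu> (k # xs))) /
        real (2 ^ ?K \<alpha> \<nu> (k # xs) * 2 ^ ?K \<alpha> \<nu> (k # xs))\<bar> \<le> 1 / 2 ^ k"
      unfolding x_def y_def by simp
  qed
qed

lemma computable_real_if:
  assumes Q: "computable S n (\<lambda>\<alpha> \<nu> xs. of_bool (Q \<alpha> \<nu> xs))"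
    and "computable_real S n F" "computable_real S n G"
  shows "computable_real S n (\<lambda>\<alpha> \<nu> xs. if Q \<alpha> \<nu> xs then F \<alpha> \<nu> xs else G \<alpha> \<nu> xs)"
proof -
  obtain P N where a: "approximates S n P N F"
    using assms(2) unfolding computable_real_def by blast
  note PN = approximatesD(1,2)[OF a] and F = approximatesD(3)[OF a]
  obtain P' N' where a': "approximates S n P' N' G"
    using assms(3) unfolding computable_real_def by blast
  note PN' = approximatesD(1,2)[OF a'] and G = approximatesD(3)[OF a']
  let ?i = "\<lambda>P P' \<alpha> \<nu> ys. if Q \<alpha> \<nu> (tl ys) then P \<alpha> \<nu> ys else P' \<alpha> \<nu> ys"
  have "computable S (Suc n) (?i P P')" "computable S (Suc n) (?i N N')"
    by (intro computable_if computable_tl[OF Q] PN PN')+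
  then show ?thesis
    unfolding computable_real_def approximates_def
    by (intro exI[of _ "?i P P'"] exI[of _ "?i N N'"]) (auto simp: F G)
qed

lemma computable_real_sum:
  assumes "computable_real S (Suc n) F" and b: "computable S n b"
  shows "computable_real S n (\<lambda>\<alpha> \<nu> xs. \<Sum>j<b \<alpha> \<nu> xs. F \<alpha> \<nu> (j # xs))"
proof -
  obtain P N where a: "approximates S (Suc n) P N F"
    using assms(1) unfolding computable_real_def by blast
  note PN = approximatesD(1,2)[OF a] and F = approximatesD(3)[OF a]
  \<comment> \<open>The b errors of 2 / 2^K stay below 1 / 2^k because b < 2^b.\<close>
  let ?K = "\<lambda>\<alpha> \<nu> ys. hd ys + 1 + b \<alpha> \<nu> (tl ys)"
  have K: "computable S (Suc n) ?K"
    by (intro computable_add computable_hd computable_tl b computable_const)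
  let ?s = "\<lambda>P \<alpha> \<nu> ys. \<Sum>j<b \<alpha> \<nu> (tl ys). P \<alpha> \<nu> (?K \<alpha> \<nu> ys # j # tl ys)"
  have s: "computable S (Suc n) (?s P)" if "computable S (Suc (Suc n)) P" for P
    using computable_sum[OF computable_replace_second[OF that computable_tl[OF K]] computable_tl[OF b]]
    by simp
  show ?thesis
  proof (rule computable_realI)
    show "computable S (Suc n) (?s P)" "computable S (Suc n) (?s N)"
      by (intro s PN)+
    show "computable S (Suc n) (\<lambda>\<alpha> \<nu> ys. 2 ^ ?K \<alpha> \<nu> ys)"
      by (intro computable_power K computable_const)
    fix \<alpha> \<nu> k and xs :: "nat list"
    assume asm: "\<alpha> \<in> S" "length xs = n"
    define K where "K = k + 1 + b \<alpha> \<nu> xs"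
    let ?f = "\<lambda>j. (real (P \<alpha> \<nu> (K # j # xs)) - real (N \<alpha> \<nu> (K # j # xs))) / 2 ^ K"
    have "\<bar>(\<Sum>j<b \<alpha> \<nu> xs. F \<alpha> \<nu> (j # xs)) - (\<Sum>j<b \<alpha> \<nu> xs. ?f j)\<bar>
        \<le> (\<Sum>j<b \<alpha> \<nu> xs. \<bar>F \<alpha> \<nu> (j # xs) - ?f j\<bar>)"
      unfolding sum_subtractf[symmetric] by (rule sum_abs)
    also have "\<dots> \<le> (\<Sum>j<b \<alpha> \<nu> xs. 2 / 2 ^ K)"
      by (intro sum_mono F) (use asm in auto)
    also have "\<dots> = 2 / 2 ^ K * real (b \<alpha> \<nu> xs)"
      by simp
    also have "\<dots> \<le> 2 / 2 ^ K * 2 ^ b \<alpha> \<nu> xs"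
      by (intro mult_left_mono less_imp_le of_nat_less_two_power) simp
    also have "\<dots> = 1 / 2 ^ k"
      by (simp add: K_def power_add)
    finally show "0 < (2::nat) ^ ?K \<alpha> \<nu> (k # xs) \<and>
      \<bar>(\<Sum>j<b \<alpha> \<nu> xs. F \<alpha> \<nu> (j # xs)) - (real (?s P \<alpha> \<nu> (k # xs)) - real (?s N \<alpha> \<nu> (k # xs))) /
        real (2 ^ ?K \<alpha> \<nu> (k # xs))\<bar> \<le> 1 / 2 ^ k"
      unfolding list.sel K_def[symmetric]
      by (simp add: sum_subtractf sum_divide_distrib[symmetric])
  qed
qed

lemma computable_real_half_power:
  assumes f: "computable S n f"
  shows "computable_real S n (\<lambda>\<alpha> \<nu> xs. 2 powr (- (real (f \<alpha> \<nu> xs) / 2)))"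
proof -
  \<comment> \<open>The least zero q is the integer part of 2^k * 2^(-j/2), where j is the value of
    \<open>f\<close>. Squaring turns the comparison of q + 1 with this irrational bound into one
    between natural numbers.\<close>
  let ?t = "\<lambda>\<alpha> \<nu> zs. of_bool ((zs ! 0 + 1) ^ 2 * 2 ^ f \<alpha> \<nu> (tl (tl zs)) \<le> 4 ^ (zs ! 1)) :: nat"
  let ?q = "\<lambda>\<alpha> \<nu> ys. LEAST q. ?t \<alpha> \<nu> (q # ys) = 0"
  have ex: "\<exists>q. ?t \<alpha> \<nu> (q # ys) = 0" for \<alpha> \<nu> ys
  proof -
    let ?q = "4 ^ (ys ! 0) :: nat"
    have "?q < ?q + 1" by simp
    also have "\<dots> \<le> (?q + 1) ^ 2"
      by (simp add: power2_eq_square)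
    also have "\<dots> \<le> (?q + 1) ^ 2 * 2 ^ f \<alpha> \<nu> (tl ys)"
      by simp
    finally show ?thesis
      by (intro exI[of _ ?q]) simp
  qed
  have "computable S (Suc (Suc n)) ?t"
    by (intro computable_intros computable_tl f) auto
  then have q: "computable S (Suc n) ?q"
    by (rule computable_Least) (rule ex)
  show ?thesis
  proof (rule computable_realI[OF q computable_const[of _ _ 0]])
    show "computable S (Suc n) (\<lambda>\<alpha> \<nu> ys. 2 ^ hd ys)"
      by (intro computable_intros computable_hd)
    fix \<alpha> \<nu> k and xs :: "nat list"
    define j where "j = f \<alpha> \<nu> xs"
    define q where "q = ?q \<alpha> \<nu> (k # xs)"
    define h :: real where "h = 2 powr (- (real j / 2))"
    have h: "h > 0" "h ^ 2 = 1 / 2 ^ j"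
      by (auto simp: h_def powr_power powr_minus powr_realpow field_simps)
    have "?t \<alpha> \<nu> (q # k # xs) = 0"
      unfolding q_def by (rule LeastI_ex[OF ex])
    then have "4 ^ k < (q + 1) ^ 2 * 2 ^ j"
      by (simp add: j_def)
    then have "real (4 ^ k) < real ((q + 1) ^ 2 * 2 ^ j)"
      unfolding of_nat_less_iff .
    then have "h ^ 2 * 4 ^ k < (real q + 1) ^ 2"
      by (simp add: h field_simps)
    then have "(h * 2 ^ k) ^ 2 < (real q + 1) ^ 2"
      by (simp add: power_mult_distrib power2_eq_square[of "2 ^ k"] power_mult_distrib[symmetric])
    then have u: "h * 2 ^ k < real q + 1"
      by (rule power2_less_imp_less) simp
    have l: "real q \<le> h * 2 ^ k"
    proof (cases q)
      case 0
      then show ?thesis using h by simp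
    next
      case (Suc q')
      have "?t \<alpha> \<nu> (q' # k # xs) \<noteq> 0"
        using not_less_Least[of q' "\<lambda>q. ?t \<alpha> \<nu> (q # k # xs) = 0"] Suc unfolding q_def by linarith
      then have "q ^ 2 * 2 ^ j \<le> 4 ^ k"
        using Suc by (simp add: j_def split: if_splits)
      then have "real (q ^ 2 * 2 ^ j) \<le> real (4 ^ k)"
        unfolding of_nat_le_iff .
      then have "(real q) ^ 2 \<le> h ^ 2 * 4 ^ k"
        by (simp add: h field_simps)
      then have "(real q) ^ 2 \<le> (h * 2 ^ k) ^ 2"
        by (simp add: power_mult_distrib power2_eq_square[of "2 ^ k"] power_mult_distrib[symmetric])
      then show ?thesis
        by (rule power2_le_imp_le) (use h in simp)
    qed
    have "\<bar>(h * 2 ^ k - real q) / 2 ^ k\<bar> \<le> 1 / 2 ^ k"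
      unfolding abs_divide using u l by (simp add: divide_right_mono)
    then have "\<bar>h - real q / 2 ^ k\<bar> \<le> 1 / 2 ^ k"
      by (simp add: diff_divide_distrib)
    then show "0 < (2::nat) ^ hd (k # xs) \<and> \<bar>2 powr (- (real (f \<alpha> \<nu> xs) / 2)) -
        (real (?q \<alpha> \<nu> (k # xs)) - real 0) / real (2 ^ hd (k # xs))\<bar> \<le> 1 / 2 ^ k"
      unfolding q_def[symmetric] j_def[symmetric] h_def[symmetric] by simp
  qed
qed

text \<open>The coefficients are computed from \<alpha> alone. The same programs run unchanged with
  \<nu> as a further oracle, since a halting computation only queries oracles that were present
  already.\<close>

lemma computes_append: "computes As p xs y \<Longrightarrow> computes (As @ Bs) p xs y"
proof (induction rule: computes.induct)
  case (Oracle i x)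
  then show ?case
    using computes.Oracle[of i "As @ Bs" x] by (simp add: nth_append)
next
  case (Comp xs gs ys f z)
  then show ?case
    by (intro computes.Comp[of "As @ Bs" xs gs ys]) (auto simp: list_all2_conv_all_nth)
next
  case (Mu f n xs)
  then show ?case
    by (intro computes.Mu) blast+
qed (auto intro: computes.intros)

lemma computable_real_of_computable_reals_on:
  assumes F: "computable_reals_on S D F" and gs: "\<And>g. g \<in> set gs \<Longrightarrow> computable S n g"
    and D: "\<And>\<alpha> \<nu> xs. \<alpha> \<in> S \<Longrightarrow> length xs = n \<Longrightarrow> map (\<lambda>g. g \<alpha> \<nu> xs) gs \<in> D"
  shows "computable_real S n (\<lambda>\<alpha> \<nu> xs. F \<alpha> (map (\<lambda>g. g \<alpha> \<nu> xs) gs))"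
proof -
  obtain p where "\<forall>\<alpha>\<in>S. \<forall>xs\<in>D. \<forall>k. \<exists>m. computes [\<alpha>] p (k # xs) m \<and>
     \<bar>F \<alpha> xs - of_int (int_decode m) / 2 ^ k\<bar> \<le> 1 / 2 ^ k"
    using F unfolding computable_reals_on_def by blast
  then obtain m where m: "\<And>\<alpha> xs k. \<alpha> \<in> S \<Longrightarrow> xs \<in> D \<Longrightarrow> computes [\<alpha>] p (k # xs) (m \<alpha> xs k)"
    and F: "\<And>\<alpha> xs k. \<alpha> \<in> S \<Longrightarrow> xs \<in> D \<Longrightarrow> \<bar>F \<alpha> xs - of_int (int_decode (m \<alpha> xs k)) / 2 ^ k\<bar> \<le> 1 / 2 ^ k"
    by metis
  let ?m = "\<lambda>\<alpha> \<nu> ys. m \<alpha> (map (\<lambda>g. g \<alpha> \<nu> (tl ys)) gs) (hd ys)"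
  have M: "computable S (Suc n) ?m"
  \<comment> \<open>The given program is only known to halt on arguments in \<open>D\<close>, so
    \<open>computable_Comp\<close> is used rather than \<open>computable_compose\<close>.\<close>
  proof (rule computable_Comp[where p = p and gs = "(\<lambda>\<alpha> \<nu> ys. hd ys) # map (\<lambda>g \<alpha> \<nu> ys. g \<alpha> \<nu> (tl ys)) gs"])
    fix \<alpha> :: cantor and \<nu> :: cantor and ys :: "nat list"
    assume "\<alpha> \<in> S" "length ys = Suc n"
    then show "computes [\<alpha>, \<nu>] p
        (map (\<lambda>g. g \<alpha> \<nu> ys) ((\<lambda>\<alpha> \<nu> ys. hd ys) # map (\<lambda>g \<alpha> \<nu> ys. g \<alpha> \<nu> (tl ys)) gs)) (?m \<alpha> \<nu> ys)"
      using computes_append[OF m[of \<alpha> "map (\<lambda>g. g \<alpha> \<nu> (tl ys)) gs" "hd ys"], of "[\<nu>]"] D[of \<alpha> "tl ys" \<nu>]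
      by (simp add: o_def)
  next
    fix g assume "g \<in> set ((\<lambda>\<alpha> \<nu> ys. hd ys) # map (\<lambda>g \<alpha> \<nu> ys. g \<alpha> \<nu> (tl ys)) gs)"
    then show "computable S (Suc n) g"
      by (auto intro: computable_hd computable_tl gs)
  qed
  \<comment> \<open>Even codes stand for nonnegative integers and odd codes for negative ones, which
    yields the two natural numerators.\<close>
  have int_decode: "real_of_int (int_decode a) = real (if a mod 2 = 0 then a div 2 else 0) -
      real (if a mod 2 = 0 then 0 else Suc (a div 2))" for a
    by (auto simp: int_decode_def sum_decode_def even_iff_mod_2_eq_zero)
  show ?thesis
  proof (rule computable_realI)
    show "computable S (Suc n) (\<lambda>\<alpha> \<nu> ys. if ?m \<alpha> \<nu> ys mod 2 = 0 then ?m \<alpha> \<nu> ys div 2 else 0)"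
      "computable S (Suc n) (\<lambda>\<alpha> \<nu> ys. if ?m \<alpha> \<nu> ys mod 2 = 0 then 0 else Suc (?m \<alpha> \<nu> ys div 2))"
      "computable S (Suc n) (\<lambda>\<alpha> \<nu> ys. 2 ^ hd ys)"
      by (intro computable_if computable_eq computable_mod computable_div computable_const computable_Suc M
          computable_power computable_hd)+
    fix \<alpha> :: cantor and \<nu> :: cantor and k and xs :: "nat list"
    assume "\<alpha> \<in> S" "length xs = n"
    then show "0 < (2::nat) ^ hd (k # xs) \<and> \<bar>F \<alpha> (map (\<lambda>g. g \<alpha> \<nu> xs) gs) -
        (real (if ?m \<alpha> \<nu> (k # xs) mod 2 = 0 then ?m \<alpha> \<nu> (k # xs) div 2 else 0) -
         real (if ?m \<alpha> \<nu> (k # xs) mod 2 = 0 then 0 else Suc (?m \<alpha> \<nu> (k # xs) div 2))) /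
        real (2 ^ hd (k # xs))\<bar> \<le> 1 / 2 ^ k"
      unfolding int_decode[symmetric] using F[of \<alpha> "map (\<lambda>g. g \<alpha> \<nu> xs) gs" k] D[of \<alpha> xs \<nu>] by simp
  qed
qed

text \<open>Both sides carry an error of 2 units of 2^-k. A true bound of 1 unit thus shows up as
  less than 5 between the approximations, and an observed 5 guarantees less than 9.\<close>

lemma computable_real_less:
  assumes "computable_real S n F" "computable_real S n G"
  obtains Q where "computable S (Suc n) (\<lambda>\<alpha> \<nu> ys. of_bool (Q \<alpha> \<nu> ys))"
    "\<And>\<alpha> \<nu> k xs. \<alpha> \<in> S \<Longrightarrow> length xs = n \<Longrightarrow> F \<alpha> \<nu> xs < G \<alpha> \<nu> xs + 1 / 2 ^ k \<Longrightarrow> Q \<alpha> \<nu> (k # xs)"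
    "\<And>\<alpha> \<nu> k xs. \<alpha> \<in> S \<Longrightarrow> length xs = n \<Longrightarrow> Q \<alpha> \<nu> (k # xs) \<Longrightarrow> F \<alpha> \<nu> xs < G \<alpha> \<nu> xs + 9 / 2 ^ k"
proof -
  obtain P N where a: "approximates S n P N F"
    using assms(1) unfolding computable_real_def by blast
  note PN = approximatesD(1,2)[OF a] and F = approximatesD(3)[OF a]
  obtain P' N' where a': "approximates S n P' N' G"
    using assms(2) unfolding computable_real_def by blast
  note PN' = approximatesD(1,2)[OF a'] and G = approximatesD(3)[OF a']
  define Q where "Q \<alpha> \<nu> ys \<longleftrightarrow> P \<alpha> \<nu> ys + N' \<alpha> \<nu> ys < P' \<alpha> \<nu> ys + N \<alpha> \<nu> ys + 5" for \<alpha> \<nu> ys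
  have Q_iff: "Q \<alpha> \<nu> (k # xs) \<longleftrightarrow> (real (P \<alpha> \<nu> (k # xs)) - real (N \<alpha> \<nu> (k # xs))) / 2 ^ k <
      (real (P' \<alpha> \<nu> (k # xs)) - real (N' \<alpha> \<nu> (k # xs))) / 2 ^ k + 5 / 2 ^ k" for \<alpha> \<nu> k xs
    unfolding Q_def add_divide_distrib[symmetric] by (simp add: divide_less_cancel) linarith
  show thesis
  proof (rule that)
    show "computable S (Suc n) (\<lambda>\<alpha> \<nu> ys. of_bool (Q \<alpha> \<nu> ys))"
      unfolding Q_def by (intro computable_less computable_add PN PN' computable_const)
  next
    fix \<alpha> :: cantor and \<nu> :: cantor and k and xs :: "nat list"
    assume "\<alpha> \<in> S" "length xs = n" "F \<alpha> \<nu> xs < G \<alpha> \<nu> xs + 1 / 2 ^ k"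
    then show "Q \<alpha> \<nu> (k # xs)"
      unfolding Q_iff using F[of \<alpha> xs \<nu> k] G[of \<alpha> xs \<nu> k] by (simp add: abs_le_iff)
  next
    fix \<alpha> :: cantor and \<nu> :: cantor and k and xs :: "nat list"
    assume "\<alpha> \<in> S" "length xs = n" "Q \<alpha> \<nu> (k # xs)"
    then show "F \<alpha> \<nu> xs < G \<alpha> \<nu> xs + 9 / 2 ^ k"
      unfolding Q_iff using F[of \<alpha> xs \<nu> k] G[of \<alpha> xs \<nu> k] by (simp add: abs_le_iff)
  qed
qed

section \<open>Binary expansions and dyadic points\<close>

definition digits :: "cantor \<Rightarrow> nat \<Rightarrow> nat" where
  "digits \<nu> k = (\<Sum>i<k. of_bool (\<nu> i) * 2 ^ (k - Suc i))"

lemma computable_digits: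
  assumes "computable S n f"
  shows "computable S n (\<lambda>\<alpha> \<nu> xs. digits \<nu> (f \<alpha> \<nu> xs))"
proof -
  have "computable S (Suc n) (\<lambda>\<alpha> \<nu> ys. of_bool (\<nu> (hd ys)) * 2 ^ (f \<alpha> \<nu> (tl ys) - Suc (hd ys)))"
    by (intro computable_intros computable_hd computable_tl assms)
  from computable_sum[OF this assms] show ?thesis
    by (simp add: digits_def)
qed

text \<open>The tail of the expansion lies between 0 and a geometric series. The upper bound is
  attained when all later digits are 1, so \<open>digits\<close> need not be the integer part of 2^k
  * t, and strictness fails.\<close>

lemma digits_bounds:
  "real (digits \<nu> k) / 2 ^ k \<le> binary_real \<nu>" "binary_real \<nu> \<le> (real (digits \<nu> k) + 1) / 2 ^ k"
proof -
  let ?f = "\<lambda>i. of_bool (\<nu> i) / 2 ^ (i + 1) :: real"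
  have geo: "(\<lambda>i. (1 / 2) ^ Suc i :: real) sums 1"
    by (rule power_half_series)
  have le: "?f i \<le> (1 / 2) ^ Suc i" "0 \<le> ?f i" for i
    by (auto simp: power_divide)
  have f: "summable ?f"
    by (rule summable_comparison_test[OF _ sums_summable[OF geo]])
      (use le in \<open>auto intro!: exI[of _ 0]\<close>)
  have digits: "real (digits \<nu> k) / 2 ^ k = (\<Sum>i<k. ?f i)"
    unfolding digits_def sum_divide_distrib of_nat_sum
  proof (rule sum.cong)
    fix i assume "i \<in> {..<k}"
    then have "(2::real) ^ k = 2 ^ (k - Suc i) * 2 ^ (i + 1)"
      by (simp add: power_add[symmetric] del: power_Suc)
    then show "real (of_bool (\<nu> i) * 2 ^ (k - Suc i)) / 2 ^ k = ?f i"
      by simp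
  qed simp
  have split: "binary_real \<nu> = (\<Sum>i. ?f (i + k)) + (\<Sum>i<k. ?f i)"
    unfolding binary_real_def by (rule suminf_split_initial_segment[OF f])
  have fk: "summable (\<lambda>i. ?f (i + k))"
    using f by (subst summable_iff_shift)
  show "real (digits \<nu> k) / 2 ^ k \<le> binary_real \<nu>"
    unfolding digits split using suminf_nonneg[OF fk] by simp
  have geo_k: "(\<lambda>i. (1 / 2) ^ k * (1 / 2) ^ Suc i :: real) sums ((1 / 2) ^ k * 1)"
    by (rule sums_mult[OF geo])
  have "(\<Sum>i. ?f (i + k)) \<le> (\<Sum>i. (1 / 2) ^ k * (1 / 2) ^ Suc i)"
  proof (rule suminf_le[OF _ fk sums_summable[OF geo_k]])
    fix i show "?f (i + k) \<le> (1 / 2) ^ k * (1 / 2) ^ Suc i"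
      using le(1)[of "i + k"] by (simp add: power_add mult.commute)
  qed
  also have "\<dots> = (1 / 2) ^ k"
    using sums_unique[OF geo_k] by simp
  finally show "binary_real \<nu> \<le> (real (digits \<nu> k) + 1) / 2 ^ k"
    unfolding add_divide_distrib digits split by (simp add: power_divide)
qed

lemma digits_less: "digits \<nu> k < 2 ^ k"
proof -
  have "digits \<nu> k + 1 \<le> 2 ^ k"
    unfolding digits_def
  proof (induction k)
    case (Suc k)
    have "(\<Sum>i<k. of_bool (\<nu> i) * 2 ^ (Suc k - Suc i)) = 2 * (\<Sum>i<k. of_bool (\<nu> i) * 2 ^ (k - Suc i) :: nat)"
      unfolding sum_distrib_left by (intro sum.cong) (auto simp: Suc_diff_Suc[symmetric])
    moreover have "of_bool (\<nu> k) \<le> (1::nat)"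
      by simp
    ultimately show ?case
      using Suc by (simp del: diff_Suc_Suc)
  qed simp
  then show ?thesis by simp
qed

lemma digits_tendsto: "(\<lambda>k. real (digits \<nu> k) / 2 ^ k) \<longlonglongrightarrow> binary_real \<nu>"
proof (rule tendsto_sandwich)
  show "\<forall>\<^sub>F k in sequentially. binary_real \<nu> - (1 / 2) ^ k \<le> real (digits \<nu> k) / 2 ^ k"
    using digits_bounds(2) by (auto simp: add_divide_distrib power_divide algebra_simps)
  show "\<forall>\<^sub>F k in sequentially. real (digits \<nu> k) / 2 ^ k \<le> binary_real \<nu>"
    using digits_bounds(1) by auto
  have "(\<lambda>k. binary_real \<nu> - (1 / 2) ^ k) \<longlonglongrightarrow> binary_real \<nu> - 0"
    by (intro tendsto_diff tendsto_const LIMSEQ_power_zero) auto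
  then show "(\<lambda>k. binary_real \<nu> - (1 / 2) ^ k) \<longlonglongrightarrow> binary_real \<nu>"
    by simp
qed simp

lemma binary_real_bounds: "0 \<le> binary_real \<nu>" "binary_real \<nu> \<le> 1"
  using digits_bounds[of \<nu> 0] by (auto simp: digits_def)

text \<open>On the grid of width \<open>2 ^ -m\<close>, \<open>D\<close> is the scale \<open>2 ^ (m - j)\<close> of the \<open>j\<close>-th Faber-Schauder
  level, \<open>i div D\<close> selects the hat function and \<open>hat D i\<close> is its value at \<open>i / 2 ^ m\<close>.\<close>

definition hat :: "nat \<Rightarrow> nat \<Rightarrow> real" where
  "hat D i = real (min (i mod D) (D - i mod D)) / real D"

lemma hat_double: "hat (2 * D) (2 * n) = hat D n"
proof -
  have "min (2 * r) (2 * D - 2 * r) = 2 * min r (D - r)" for r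
    by (simp add: min_def) linarith
  then show ?thesis
    by (simp add: hat_def)
qed

text \<open>For even D the peak of a hat is a grid point, so hats are linear between neighbouring
  grid points and the value at a midpoint is the mean. The coefficients vary with the support: if n
  + 1 already belongs to the next hat, its value there is 0.\<close>

lemma hat_midpoint:
  fixes c :: "nat \<Rightarrow> real"
  assumes D: "even D" "D > 0"
  shows "c ((2 * n + 1) div (2 * D)) * hat (2 * D) (2 * n + 1) =
    (c (n div D) * hat D n + c (Suc n div D) * hat D (Suc n)) / 2"
proof -
  define r where "r = n mod D"
  have r: "r < D"
    using D by (simp add: r_def)
  have div_eq: "(2 * n + 1) div (2 * D) = n div D"
    by (simp add: div_mult2_eq)
  have "(2 * n + 1) mod (2 * D) = 2 * r + 1"
    by (simp add: mod_mult2_eq r_def)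
  then have hat: "hat (2 * D) (2 * n + 1) = real (min (2 * r + 1) (2 * D - (2 * r + 1))) / (2 * D)"
    by (simp add: hat_def)
  show ?thesis
  proof (cases "Suc r = D")
    case True
    then have "hat D (Suc n) = 0"
      by (simp add: hat_def mod_Suc r_def)
    moreover have "r \<noteq> 0"
      using True D by (auto intro: odd_pos)
    then have "hat D n = 1 / D"
      using True by (auto simp: hat_def r_def[symmetric] min_def)
    moreover have "hat (2 * D) (2 * n + 1) = 1 / (2 * D)"
      using True unfolding hat by (auto simp: min_def)
    ultimately show ?thesis
      unfolding div_eq by simp
  next
    case False
    then have "Suc n div D = n div D" "Suc n mod D = Suc r"
      by (simp_all add: div_Suc mod_Suc r_def)
    moreover have "min (2 * r + 1) (2 * D - (2 * r + 1)) = min r (D - r) + min (Suc r) (D - Suc r)"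
    proof -
      obtain h where "D = 2 * h"
        using D by blast
      then show ?thesis
        using r False by (cases "r < h") (auto simp: min_def)
    qed
    then have "real (min (2 * r + 1) (2 * D - (2 * r + 1))) = real (min r (D - r)) + real (min (Suc r) (D - Suc r))"
      unfolding of_nat_add[symmetric] by (rule arg_cong)
    ultimately show ?thesis
      unfolding div_eq hat unfolding hat_def r_def[symmetric] by (simp add: add_divide_distrib distrib_left)
  qed
qed

text \<open>The hats have height 1/2, so these are exactly the increments in the recursion for 2 *
  x(midpoint). Level 0 encodes the separate rule for x(1/2).\<close>

definition schauder_coeff :: "real \<Rightarrow> (nat \<Rightarrow> nat \<Rightarrow> real) \<Rightarrow> nat \<Rightarrow> nat \<Rightarrow> real" where
  "schauder_coeff \<xi>1 \<xi> j n = (if j = 0 then \<xi>1 else \<xi> j n * 2 powr (- (real j / 2)))"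

text \<open>The reduction modulo \<open>2 ^ j\<close> only matters at \<open>i = 2 ^ m\<close>, where all hats vanish.\<close>

definition schauder_sum ::
    "real \<Rightarrow> real \<Rightarrow> (nat \<Rightarrow> nat \<Rightarrow> real) \<Rightarrow> nat \<Rightarrow> nat \<Rightarrow> real" where
  "schauder_sum \<xi>0 \<xi>1 \<xi> m i = \<xi>0 * (real i / real (2 ^ m)) +
     (\<Sum>j<m. schauder_coeff \<xi>1 \<xi> j ((i div 2 ^ (m - j)) mod 2 ^ j) * hat (2 ^ (m - j)) i)"

text \<open>Refine the grid. At old points the old hats keep their values and the new ones vanish.
  At a new point the old levels give the mean of the two neighbours and the new hat adds half its
  coefficient, which is the recursion.\<close>

lemma dyadic_recursion_eq_schauder_sum:
  assumes x: "dyadic_recursion \<xi>0 \<xi>1 \<xi> x"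
  shows "i \<le> 2 ^ m \<Longrightarrow> x (real i / 2 ^ m) = schauder_sum \<xi>0 \<xi>1 \<xi> m i"
proof (induction m arbitrary: i)
  case 0
  then consider "i = 0" | "i = 1"
    by (auto simp: le_Suc_eq)
  then show ?case
    using x by cases (auto simp: schauder_sum_def dyadic_recursion_def)
next
  case (Suc m)
  let ?c = "\<lambda>j n. schauder_coeff \<xi>1 \<xi> j (n mod 2 ^ j)"
  have dbl: "2 ^ (Suc m - j) = 2 * (2 ^ (m - j) :: nat)" if "j < m" for j
    using that by (simp add: Suc_diff_le)
  show ?case
  proof (cases "even i")
    case True
    then obtain n where n: "i = 2 * n"
      by blast
    have "(\<Sum>j<m. ?c j (i div 2 ^ (Suc m - j)) * hat (2 ^ (Suc m - j)) i) =
        (\<Sum>j<m. ?c j (n div 2 ^ (m - j)) * hat (2 ^ (m - j)) n)"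
      by (intro sum.cong) (auto simp: dbl n hat_double)
    moreover have "hat 2 i = 0"
      using True by (simp add: hat_def)
    ultimately have "schauder_sum \<xi>0 \<xi>1 \<xi> (Suc m) i = schauder_sum \<xi>0 \<xi>1 \<xi> m n"
      by (simp add: schauder_sum_def n)
    then show ?thesis
      using Suc.IH[of n] Suc.prems n by simp
  next
    case False
    then obtain n where n: "i = 2 * n + 1"
      by (blast elim: oddE)
    have nm: "n < 2 ^ m"
      using Suc.prems n by simp
    have rec: "2 * x (real i / 2 ^ Suc m) = schauder_coeff \<xi>1 \<xi> m n + x (real (Suc n) / 2 ^ m) + x (real n / 2 ^ m)"
    proof (cases "m = 0")
      case True
      then show ?thesis
        using x nm n by (simp add: dyadic_recursion_def schauder_coeff_def)
    next
      case False
      then have "2 * x ((2 * real n + 1) / 2 ^ (m + 1)) =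
          2 powr (- (real m / 2)) * \<xi> m n + x ((real n + 1) / 2 ^ m) + x (real n / 2 ^ m)"
        using x nm unfolding dyadic_recursion_def by auto
      then show ?thesis
        using False by (simp add: schauder_coeff_def n add.commute mult.commute)
    qed
    have "(\<Sum>j<m. ?c j (i div 2 ^ (Suc m - j)) * hat (2 ^ (Suc m - j)) i) =
        (\<Sum>j<m. (?c j (n div 2 ^ (m - j)) * hat (2 ^ (m - j)) n +
          ?c j (Suc n div 2 ^ (m - j)) * hat (2 ^ (m - j)) (Suc n)) / 2)"
      unfolding n by (intro sum.cong refl) (simp only: dbl lessThan_iff, rule hat_midpoint, auto)
    also have "\<dots> = ((\<Sum>j<m. ?c j (n div 2 ^ (m - j)) * hat (2 ^ (m - j)) n) +
          (\<Sum>j<m. ?c j (Suc n div 2 ^ (m - j)) * hat (2 ^ (m - j)) (Suc n))) / 2"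
      by (simp add: sum_divide_distrib[symmetric] sum.distrib)
    also have "\<dots> = (schauder_sum \<xi>0 \<xi>1 \<xi> m n - \<xi>0 * (real n / 2 ^ m) +
        (schauder_sum \<xi>0 \<xi>1 \<xi> m (Suc n) - \<xi>0 * (real (Suc n) / 2 ^ m))) / 2"
      by (simp add: schauder_sum_def)
    also have "\<dots> = (x (real n / 2 ^ m) - \<xi>0 * (real n / 2 ^ m) +
        (x (real (Suc n) / 2 ^ m) - \<xi>0 * (real (Suc n) / 2 ^ m))) / 2"
      using Suc.IH[of n] Suc.IH[of "Suc n"] nm by simp
    finally have sum_eq: "(\<Sum>j<m. ?c j (i div 2 ^ (Suc m - j)) * hat (2 ^ (Suc m - j)) i) = \<dots>" .
    have "hat 2 i = 1 / 2" "i div 2 = n"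
      by (auto simp: hat_def n)
    then have "schauder_sum \<xi>0 \<xi>1 \<xi> (Suc m) i = \<xi>0 * (real i / 2 ^ Suc m) +
        (\<Sum>j<m. ?c j (i div 2 ^ (Suc m - j)) * hat (2 ^ (Suc m - j)) i) + schauder_coeff \<xi>1 \<xi> m n / 2"
      using nm by (simp add: schauder_sum_def)
    also have "\<dots> = (schauder_coeff \<xi>1 \<xi> m n + x (real (Suc n) / 2 ^ m) + x (real n / 2 ^ m)) / 2"
      unfolding sum_eq by (simp add: n field_simps)
    finally show ?thesis
      using rec by simp
  qed
qed

lemma computable_real_schauder_sum:
  assumes \<xi>0: "computable_reals_on S {[]} (\<lambda>\<alpha> _. \<xi>0 \<alpha>)"
    and \<xi>1: "computable_reals_on S {[]} (\<lambda>\<alpha> _. \<xi>1 \<alpha>)"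
    and \<xi>: "computable_reals_on S {[j, n] | j n. 1 \<le> j \<and> n < 2 ^ j} (\<lambda>\<alpha> xs. \<xi> \<alpha> (xs ! 0) (xs ! 1))"
    and m: "computable S n m" and i: "computable S n i"
  shows "computable_real S n (\<lambda>\<alpha> \<nu> xs. schauder_sum (\<xi>0 \<alpha>) (\<xi>1 \<alpha>) (\<xi> \<alpha>) (m \<alpha> \<nu> xs) (i \<alpha> \<nu> xs))"
proof -
  let ?D = "\<lambda>\<alpha> \<nu> ys. 2 ^ (m \<alpha> \<nu> (tl ys) - hd ys)"
  let ?i = "\<lambda>\<alpha> \<nu> ys. i \<alpha> \<nu> (tl ys)"
  let ?n = "\<lambda>\<alpha> \<nu> ys. (?i \<alpha> \<nu> ys div ?D \<alpha> \<nu> ys) mod 2 ^ hd ys"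
  note intros = computable_intros computable_hd computable_tl m i
  have 0: "computable_real S n (\<lambda>\<alpha> \<nu> xs. \<xi>0 \<alpha>)"
    using computable_real_of_computable_reals_on[OF \<xi>0, of "[]" n] by simp
  have 1: "computable_real S (Suc n) (\<lambda>\<alpha> \<nu> xs. \<xi>1 \<alpha>)"
    using computable_real_of_computable_reals_on[OF \<xi>1, of "[]" "Suc n"] by simp
  \<comment> \<open>Both branches of the conditional below must be computable everywhere. At level 0
    the coefficient program is therefore called with level 1; the remainder modulo 2^j keeps the
    second index legal.\<close>
  have "computable_real S (Suc n) (\<lambda>\<alpha> \<nu> ys. (\<lambda>\<alpha> xs. \<xi> \<alpha> (xs ! 0) (xs ! 1)) \<alpha>
      (map (\<lambda>g. g \<alpha> \<nu> ys) [\<lambda>\<alpha> \<nu> ys. max 1 (hd ys), ?n]))"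
  proof (rule computable_real_of_computable_reals_on[OF \<xi>])
    fix g assume "g \<in> set [\<lambda>\<alpha> \<nu> ys. max 1 (hd ys), ?n]"
    then consider "g = (\<lambda>\<alpha> \<nu> ys. max 1 (hd ys))" | "g = ?n"
      by auto
    then show "computable S (Suc n) g"
      by cases (simp only:, intro intros)+
  next
    fix \<alpha> \<nu> and ys :: "nat list"
    have "?n \<alpha> \<nu> ys < 2 ^ hd ys"
      by simp
    also have "\<dots> \<le> 2 ^ max 1 (hd ys)"
      by (intro power_increasing) auto
    finally show "map (\<lambda>g. g \<alpha> \<nu> ys) [\<lambda>\<alpha> \<nu> ys. max 1 (hd ys), ?n] \<in> {[j, n] | j n. 1 \<le> j \<and> n < 2 ^ j}"
      by auto
  qed
  then have 2: "computable_real S (Suc n) (\<lambda>\<alpha> \<nu> ys. \<xi> \<alpha> (max 1 (hd ys)) (?n \<alpha> \<nu> ys))"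
    by simp
  have "computable S (Suc n) (\<lambda>\<alpha> \<nu> ys. of_bool (hd ys = 0))"
    by (intro intros)
  then have "computable_real S (Suc n) (\<lambda>\<alpha> \<nu> ys. if hd ys = 0 then \<xi>1 \<alpha>
      else \<xi> \<alpha> (max 1 (hd ys)) (?n \<alpha> \<nu> ys) * 2 powr (- (real (hd ys) / 2)))"
    by (intro computable_real_if computable_real_mult computable_real_half_power 1 2 computable_hd)
  then have c: "computable_real S (Suc n) (\<lambda>\<alpha> \<nu> ys. schauder_coeff (\<xi>1 \<alpha>) (\<xi> \<alpha>) (hd ys) (?n \<alpha> \<nu> ys))"
    by (rule computable_real_cong) (auto simp: schauder_coeff_def max_def)
  have h: "computable_real S (Suc n) (\<lambda>\<alpha> \<nu> ys. hat (?D \<alpha> \<nu> ys) (?i \<alpha> \<nu> ys))"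
    unfolding hat_def by (rule computable_real_ratio) ((intro intros)+, simp)
  have s: "computable_real S n (\<lambda>\<alpha> \<nu> xs. \<Sum>j<m \<alpha> \<nu> xs.
      schauder_coeff (\<xi>1 \<alpha>) (\<xi> \<alpha>) j ((i \<alpha> \<nu> xs div 2 ^ (m \<alpha> \<nu> xs - j)) mod 2 ^ j) *
      hat (2 ^ (m \<alpha> \<nu> xs - j)) (i \<alpha> \<nu> xs))"
    using computable_real_sum[OF computable_real_mult[OF c h] m] by simp
  have "computable_real S n (\<lambda>\<alpha> \<nu> xs. real (i \<alpha> \<nu> xs) / real (2 ^ m \<alpha> \<nu> xs))"
    by (rule computable_real_ratio) ((intro intros)+, simp)
  then show ?thesis
    unfolding schauder_sum_def by (intro computable_real_add computable_real_mult s 0)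
qed

section \<open>Randomness\<close>

lemma word_code_bounds: "2 ^ length u \<le> word_code u + 1 \<and> word_code u + 1 < 2 ^ Suc (length u)"
  by (induction u) auto

text \<open>The words of length l have exactly the codes from 2^l - 1 to 2^(l+1) - 2. Bounding the
  length of a word is thus bounding a number, and no decoding is required.\<close>

lemma length_less_iff_word_code: "length u < l \<longleftrightarrow> word_code u + 1 < 2 ^ l"
proof
  assume "length u < l"
  then have "(2::nat) ^ Suc (length u) \<le> 2 ^ l"
    by (intro power_increasing) auto
  then show "word_code u + 1 < 2 ^ l"
    using word_code_bounds[of u] by linarith
next
  assume "word_code u + 1 < 2 ^ l"
  then have "(2::nat) ^ length u < 2 ^ l"
    using word_code_bounds[of u] by linarith
  then show "length u < l"
    by simp
qed

lemma word_code_map: "word_code (map \<alpha> [0..<n]) = (\<Sum>i<n. 2 ^ i * (1 + of_bool (\<alpha> i)))"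
proof (induction n arbitrary: \<alpha>)
  case (Suc n)
  have "map \<alpha> [0..<Suc n] = \<alpha> 0 # map (\<lambda>i. \<alpha> (Suc i)) [0..<n]"
    by (simp only: map_upt_Suc)
  then show ?case
    using Suc[of "\<lambda>i. \<alpha> (Suc i)"]
    by (simp add: sum.lessThan_Suc_shift sum_distrib_left mult.assoc del: upt_Suc sum.lessThan_Suc)
qed simp

lemma computable_word_code:
  assumes "computable S n f"
  shows "computable S n (\<lambda>\<alpha> \<nu> xs. word_code (map \<alpha> [0..<f \<alpha> \<nu> xs]))"
proof -
  have "computable S (Suc n) (\<lambda>\<alpha> \<nu> ys. 2 ^ hd ys * (1 + of_bool (\<alpha> (hd ys))))"
    by (intro computable_intros computable_hd)
  from computable_sum[OF this assms] show ?thesis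
    by (simp add: word_code_map)
qed

text \<open>That no word shorter than n - d describes the prefix means that no simulation of such a
  word ever returns it. As \<open>word_code\<close> is a bijection, the words can be replaced by all
  numbers v.\<close>

lemma KC_iff_fuel:
  assumes U: "\<And>u v. computes [] p [word_code u] (word_code v) \<longleftrightarrow> U u = Some v"
  shows "\<alpha> \<in> KC U \<longleftrightarrow>
    (\<exists>d. \<forall>n v c. v + 1 < 2 ^ (n - d) \<longrightarrow> fuel [] p c [v] \<noteq> Suc (word_code (map \<alpha> [0..<n])))"
proof -
  have "enat n \<le> complexity U w + enat d \<longleftrightarrow>
      (\<forall>v c. v + 1 < 2 ^ (n - d) \<longrightarrow> fuel [] p c [v] \<noteq> Suc (word_code w))" for n d w
  proof -
    \<comment> \<open>The subtraction is truncated: for n \<le> d both sides hold.\<close>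
    have "enat n \<le> complexity U w + enat d \<longleftrightarrow> enat (n - d) \<le> complexity U w"
      by (cases "complexity U w") auto
    also have "\<dots> \<longleftrightarrow> (\<forall>u. U u = Some w \<longrightarrow> n - d \<le> length u)"
      by (simp add: complexity_def le_INF_iff)
    also have "\<dots> \<longleftrightarrow> (\<forall>u. length u < n - d \<longrightarrow> \<not> computes [] p [word_code u] (word_code w))"
      unfolding U by (auto simp: not_less)
    also have "\<dots> \<longleftrightarrow> (\<forall>v. v + 1 < 2 ^ (n - d) \<longrightarrow> \<not> computes [] p [v] (word_code w))"
      unfolding length_less_iff_word_code using bij_word_code by (metis bij_pointE)
    also have "\<dots> \<longleftrightarrow> (\<forall>v c. v + 1 < 2 ^ (n - d) \<longrightarrow> fuel [] p c [v] \<noteq> Suc (word_code w))"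
      unfolding computes_iff_fuel by blast
    finally show ?thesis .
  qed
  then show ?thesis
    unfolding KC_def by simp
qed

section \<open>Local minimizers\<close>

text \<open>\<open>fits s J m \<tau>\<close> and \<open>near s J m \<tau> i\<close> express, through the first \<open>m\<close> binary digits \<open>\<tau>\<close> of \<open>t\<close>,
  that the interval of length \<open>2 ^ -J\<close> to the right (\<open>s = 0\<close>) or left (\<open>s \<noteq> 0\<close>) of \<open>t\<close> lies in
  \<open>[0, 1]\<close> and that \<open>i / 2 ^ m\<close> belongs to it. Both are exact only in the limit of large \<open>m\<close>.\<close>

definition fits :: "nat \<Rightarrow> nat \<Rightarrow> nat \<Rightarrow> nat \<Rightarrow> bool" where
  "fits s J m \<tau> \<longleftrightarrow> (if s = 0 then \<tau> + 2 ^ (m - J) \<le> 2 ^ m else 2 ^ (m - J) \<le> \<tau> + 1)"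

definition near :: "nat \<Rightarrow> nat \<Rightarrow> nat \<Rightarrow> nat \<Rightarrow> nat \<Rightarrow> bool" where
  "near s J m \<tau> i \<longleftrightarrow>
     (if s = 0 then \<tau> < i \<and> i < \<tau> + 2 ^ (m - J) else \<tau> + 1 < i + 2 ^ (m - J) \<and> i \<le> \<tau>)"

text \<open>Keeps the tested points inside [0, 1], where the evaluation by Faber-Schauder sums is
  valid.\<close>

lemma near_le: "fits s J m (digits \<nu> m) \<Longrightarrow> near s J m (digits \<nu> m) i \<Longrightarrow> i \<le> 2 ^ m"
  using digits_less[of \<nu> m] by (auto simp: fits_def near_def split: if_splits)

text \<open>The truncations of s to m binary places tend to s from below. They stay under u,
  eventually exceed l, and continuity carries the inequality to s.\<close>

lemma le_by_dyadic_approximation: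
  fixes x :: "real \<Rightarrow> real"
  assumes x: "continuous_on {0..1} x" and s: "0 \<le> s" "s \<le> 1" "l < s" "s < u"
    and le: "\<forall>\<^sub>F m in sequentially. \<forall>i. l < real i / 2 ^ m \<longrightarrow> real i / 2 ^ m < u \<longrightarrow> y \<le> x (real i / 2 ^ m)"
  shows "y \<le> x s"
proof -
  define q where "q m = real (nat \<lfloor>s * 2 ^ m\<rfloor>) / 2 ^ m" for m :: nat
  have q: "q m \<le> s" "s - (1 / 2) ^ m \<le> q m" for m
  proof -
    define z where "z = real (nat \<lfloor>s * 2 ^ m\<rfloor>)"
    have "z = of_int \<lfloor>s * 2 ^ m\<rfloor>"
      using s by (simp add: z_def)
    then have "z \<le> s * 2 ^ m" "s * 2 ^ m \<le> z + 1"
      by linarith+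
    then have "z / 2 ^ m \<le> s * 2 ^ m / 2 ^ m" "s * 2 ^ m / 2 ^ m \<le> (z + 1) / 2 ^ m"
      by (simp_all only: divide_right_mono zero_le_power zero_le_numeral)
    then show "q m \<le> s" "s - (1 / 2) ^ m \<le> q m"
      unfolding q_def z_def[symmetric] by (simp_all add: add_divide_distrib power_divide)
  qed
  have "(\<lambda>m. s - (1 / 2) ^ m) \<longlonglongrightarrow> s - 0"
    by (intro tendsto_diff tendsto_const LIMSEQ_power_zero) auto
  then have lim: "q \<longlonglongrightarrow> s"
    by (intro tendsto_sandwich[of "\<lambda>m. s - (1 / 2) ^ m" q sequentially "\<lambda>_. s"]) (use q in auto)
  have "0 \<le> q m" "q m \<le> 1" for m
    using order_trans[OF q(1)[of m] s(2)] by (simp_all only: q_def zero_le_divide_iff of_nat_0_le_iff zero_le_power zero_le_numeral simp_thms)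
  then have "(\<lambda>m. x (q m)) \<longlonglongrightarrow> x s"
    using continuous_on_tendsto_compose[OF x lim] s by simp
  moreover have "\<forall>\<^sub>F m in sequentially. y \<le> x (q m)"
    using le order_tendstoD(1)[OF lim \<open>l < s\<close>]
  proof eventually_elim
    case (elim m)
    have "q m < u"
      using q(1)[of m] s by linarith
    then show ?case
      using elim unfolding q_def by blast
  qed
  ultimately show ?thesis
    by (rule tendsto_lowerbound) simp
qed

section \<open>The grid tests as inequalities between reals\<close>

lemma power_diff_divide:
  assumes "J \<le> m"
  shows "(2::real) ^ (m - J) / 2 ^ m = 1 / 2 ^ J"
  using assms by (simp add: power_diff)

lemma fits_right_iff:
  assumes "J \<le> m"
  shows "fits 0 J m \<tau> \<longleftrightarrow> real \<tau> / 2 ^ m + 1 / 2 ^ J \<le> 1"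
proof -
  have "fits 0 J m \<tau> \<longleftrightarrow> real (\<tau> + 2 ^ (m - J)) \<le> real (2 ^ m)"
    unfolding fits_def of_nat_le_iff by simp
  also have "\<dots> \<longleftrightarrow> (real \<tau> + 2 ^ (m - J)) / 2 ^ m \<le> 1"
    by simp
  finally show ?thesis
    by (simp add: add_divide_distrib power_diff_divide[OF assms])
qed

lemma fits_left_iff:
  assumes "J \<le> m"
  shows "fits 1 J m \<tau> \<longleftrightarrow> 1 / 2 ^ J \<le> (real \<tau> + 1) / 2 ^ m"
proof -
  have "fits 1 J m \<tau> \<longleftrightarrow> real (2 ^ (m - J)) \<le> real (\<tau> + 1)"
    unfolding fits_def of_nat_le_iff by simp
  also have "\<dots> \<longleftrightarrow> 2 ^ (m - J) / 2 ^ m \<le> (real \<tau> + 1) / 2 ^ m"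
    by (simp add: divide_le_cancel add.commute)
  finally show ?thesis
    by (simp add: power_diff_divide[OF assms])
qed

lemma near_right_iff:
  assumes "J \<le> m"
  shows "near 0 J m \<tau> i \<longleftrightarrow>
    (real \<tau> + 1) / 2 ^ m \<le> real i / 2 ^ m \<and> real i / 2 ^ m < real \<tau> / 2 ^ m + 1 / 2 ^ J"
proof -
  have "near 0 J m \<tau> i \<longleftrightarrow> real (\<tau> + 1) \<le> real i \<and> real i < real (\<tau> + 2 ^ (m - J))"
    unfolding near_def of_nat_le_iff of_nat_less_iff by auto
  also have "\<dots> \<longleftrightarrow> (real \<tau> + 1) / 2 ^ m \<le> real i / 2 ^ m \<and> real i / 2 ^ m < (real \<tau> + 2 ^ (m - J)) / 2 ^ m"
    by (simp add: divide_le_cancel divide_less_cancel add.commute)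
  finally show ?thesis
    by (simp add: add_divide_distrib power_diff_divide[OF assms])
qed

lemma near_left_iff:
  assumes "J \<le> m"
  shows "near 1 J m \<tau> i \<longleftrightarrow>
    (real \<tau> + 1) / 2 ^ m < real i / 2 ^ m + 1 / 2 ^ J \<and> real i / 2 ^ m \<le> real \<tau> / 2 ^ m"
proof -
  have "near 1 J m \<tau> i \<longleftrightarrow> real (\<tau> + 1) < real (i + 2 ^ (m - J)) \<and> real i \<le> real \<tau>"
    unfolding near_def of_nat_le_iff of_nat_less_iff by auto
  also have "\<dots> \<longleftrightarrow> (real \<tau> + 1) / 2 ^ m < (real i + 2 ^ (m - J)) / 2 ^ m \<and> real i / 2 ^ m \<le> real \<tau> / 2 ^ m"
    by (simp add: divide_le_cancel divide_less_cancel add.commute)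
  finally show ?thesis
    by (simp add: add_divide_distrib power_diff_divide[OF assms])
qed

lemma digits_Suc_tendsto: "(\<lambda>m. (real (digits \<nu> m) + 1) / 2 ^ m) \<longlonglongrightarrow> binary_real \<nu>"
proof -
  have "(\<lambda>m. real (digits \<nu> m) / 2 ^ m + (1 / 2) ^ m) \<longlonglongrightarrow> binary_real \<nu> + 0"
    by (intro tendsto_add digits_tendsto LIMSEQ_power_zero) auto
  then show ?thesis
    by (simp add: add_divide_distrib power_divide)
qed

lemma ex_inverse_power_less:
  assumes "0 < (e::real)"
  obtains J :: nat where "1 / 2 ^ J < e"
  using real_arch_pow_inv[OF assms, of "1 / 2"] by (auto simp: power_divide)

text \<open>At every finite m, \<open>fits\<close> is implied by the true inclusion of the interval
  and \<open>near\<close> implies true membership. A genuine minimizer therefore passes all tests.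
  Conversely, as m grows, the tests exhaust the open one-sided interval and force it into
  [0, 1].\<close>

lemma local_minimizers_iff:
  assumes x: "continuous_on {0..1} x"
  shows "binary_real \<nu> \<in> local_minimizers x \<longleftrightarrow>
    (\<exists>J s. \<forall>m\<ge>J. fits s J m (digits \<nu> m) \<and>
       (\<forall>i. near s J m (digits \<nu> m) i \<longrightarrow> x (binary_real \<nu>) \<le> x (real i / 2 ^ m)))"
    (is "_ \<longleftrightarrow> (\<exists>J s. ?R J s)")
proof
  let ?t = "binary_real \<nu>"
  assume "?t \<in> local_minimizers x"
  then obtain a b where ab: "0 \<le> a" "a < b" "b \<le> 1" "a \<le> ?t" "?t \<le> b"
    and min: "\<And>s. a \<le> s \<Longrightarrow> s \<le> b \<Longrightarrow> x ?t \<le> x s"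
    unfolding local_minimizers_def by auto
  show "\<exists>J s. ?R J s"
  proof (cases "?t < b")
    case True
    then obtain J :: nat where J: "1 / 2 ^ J < b - ?t"
      using ex_inverse_power_less[of "b - ?t"] by auto
    have "?R J 0"
    proof (intro allI impI conjI)
      fix m assume m: "J \<le> m"
      show "fits 0 J m (digits \<nu> m)"
        unfolding fits_right_iff[OF m] using digits_bounds(1)[of \<nu> m] J ab by linarith
      fix i assume "near 0 J m (digits \<nu> m) i"
      then show "x ?t \<le> x (real i / 2 ^ m)"
        unfolding near_right_iff[OF m] using digits_bounds[of \<nu> m] J ab by (intro min) linarith+
    qed
    then show ?thesis by blast
  next
    case False
    then obtain J :: nat where J: "1 / 2 ^ J < ?t - a"
      using ex_inverse_power_less[of "?t - a"] ab by auto
    have "?R J 1"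
    proof (intro allI impI conjI)
      fix m assume m: "J \<le> m"
      show "fits 1 J m (digits \<nu> m)"
        unfolding fits_left_iff[OF m] using digits_bounds(2)[of \<nu> m] J ab by linarith
      fix i assume "near 1 J m (digits \<nu> m) i"
      then show "x ?t \<le> x (real i / 2 ^ m)"
        unfolding near_left_iff[OF m] using digits_bounds[of \<nu> m] J ab by (intro min) linarith+
    qed
    then show ?thesis by blast
  qed
next
  let ?t = "binary_real \<nu>"
  assume "\<exists>J s. ?R J s"
  then obtain J s where "?R J s"
    by blast
  \<comment> \<open>\<open>s\<close> will be a decoded number, of which only being 0 or not
    matters.\<close>
  moreover have "fits s J m \<tau> = fits (if s = 0 then 0 else 1) J m \<tau>"
    "near s J m \<tau> i = near (if s = 0 then 0 else 1) J m \<tau> i" for m \<tau> i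
    by (auto simp: fits_def near_def)
  ultimately consider "?R J 0" | "?R J 1"
    by (cases "s = 0") auto
  then show "?t \<in> local_minimizers x"
  proof cases
    case 1
    define b where "b = ?t + 1 / 2 ^ J"
    have "(\<lambda>m. real (digits \<nu> m) / 2 ^ m + 1 / 2 ^ J) \<longlonglongrightarrow> b"
      unfolding b_def by (intro tendsto_add digits_tendsto tendsto_const)
    moreover have "\<forall>\<^sub>F m in sequentially. real (digits \<nu> m) / 2 ^ m + 1 / 2 ^ J \<le> 1"
      using eventually_ge_at_top[of J] by eventually_elim (use 1 fits_right_iff in blast)
    ultimately have b1: "b \<le> 1"
      by (intro tendsto_upperbound[of _ b sequentially]) auto
    have min: "x ?t \<le> x s" if s: "?t < s" "s < b" for s
    proof -
      \<comment> \<open>The window from (t + s) / 2 to u around s has a margin on both sides, so its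
        grid points satisfy \<open>near\<close> once the digits are close enough to t.\<close>
      define u where "u = (s + b) / 2"
      have u: "s < u" "u < b"
        using s by (auto simp: u_def)
      have "\<forall>\<^sub>F m in sequentially. u < real (digits \<nu> m) / 2 ^ m + 1 / 2 ^ J"
        using \<open>(\<lambda>m. real (digits \<nu> m) / 2 ^ m + 1 / 2 ^ J) \<longlonglongrightarrow> b\<close> u(2) by (rule order_tendstoD)
      moreover have "\<forall>\<^sub>F m in sequentially. (real (digits \<nu> m) + 1) / 2 ^ m < (?t + s) / 2"
        using digits_Suc_tendsto s by (intro order_tendstoD(2)[of _ ?t]) auto
      ultimately have "\<forall>\<^sub>F m in sequentially. \<forall>i. (?t + s) / 2 < real i / 2 ^ m \<longrightarrow> real i / 2 ^ m < u \<longrightarrow>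
          x ?t \<le> x (real i / 2 ^ m)"
        using eventually_ge_at_top[of J]
      proof eventually_elim
        case (elim m)
        show ?case
        proof (intro allI impI)
          fix i assume "(?t + s) / 2 < real i / 2 ^ m" "real i / 2 ^ m < u"
          then have "near 0 J m (digits \<nu> m) i"
            unfolding near_right_iff[OF elim(3)] using elim by linarith
          then show "x ?t \<le> x (real i / 2 ^ m)"
            using 1 elim(3) by blast
        qed
      qed
      then show ?thesis
        using s u b1 binary_real_bounds[of \<nu>] by (intro le_by_dyadic_approximation[OF x, of s "(?t + s) / 2" u]) auto
    qed
    \<comment> \<open>\<open>min\<close> covers only the open interval; halving it gives a closed
      one.\<close>
    have "x ?t \<le> x s" if "s \<in> {?t..(?t + b) / 2}" for s
      using that min[of s] by (cases "s = ?t") (auto simp: b_def)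
    moreover have "?t < (?t + b) / 2" "(?t + b) / 2 \<le> 1"
      using b1 binary_real_bounds[of \<nu>] by (auto simp: b_def)
    ultimately show ?thesis
      unfolding local_minimizers_def using binary_real_bounds[of \<nu>]
      by (intro CollectI exI[of _ ?t] exI[of _ "(?t + b) / 2"]) auto
  next
    case 2
    define a where "a = ?t - 1 / 2 ^ J"
    have lim: "(\<lambda>m. (real (digits \<nu> m) + 1) / 2 ^ m - 1 / 2 ^ J) \<longlonglongrightarrow> a"
      unfolding a_def by (intro tendsto_diff digits_Suc_tendsto tendsto_const)
    moreover have "\<forall>\<^sub>F m in sequentially. 0 \<le> (real (digits \<nu> m) + 1) / 2 ^ m - 1 / 2 ^ J"
      using eventually_ge_at_top[of J] by eventually_elim (use 2 fits_left_iff in auto)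
    ultimately have a0: "0 \<le> a"
      by (intro tendsto_lowerbound[of _ a sequentially]) auto
    have min: "x ?t \<le> x s" if s: "a < s" "s < ?t" for s
    proof -
      define l where "l = (s + a) / 2"
      have l: "l < s" "a < l"
        using s by (auto simp: l_def)
      have "\<forall>\<^sub>F m in sequentially. (real (digits \<nu> m) + 1) / 2 ^ m - 1 / 2 ^ J < l"
        using lim l(2) by (rule order_tendstoD)
      moreover have "\<forall>\<^sub>F m in sequentially. (?t + s) / 2 < real (digits \<nu> m) / 2 ^ m"
        using digits_tendsto s by (intro order_tendstoD(1)[of _ ?t]) auto
      ultimately have "\<forall>\<^sub>F m in sequentially. \<forall>i. l < real i / 2 ^ m \<longrightarrow> real i / 2 ^ m < (?t + s) / 2 \<longrightarrow>
          x ?t \<le> x (real i / 2 ^ m)"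
        using eventually_ge_at_top[of J]
      proof eventually_elim
        case (elim m)
        show ?case
        proof (intro allI impI)
          fix i assume "l < real i / 2 ^ m" "real i / 2 ^ m < (?t + s) / 2"
          then have "near 1 J m (digits \<nu> m) i"
            unfolding near_left_iff[OF elim(3)] using elim by linarith
          then show "x ?t \<le> x (real i / 2 ^ m)"
            using 2 elim(3) by blast
        qed
      qed
      then show ?thesis
        using s l a0 binary_real_bounds[of \<nu>] by (intro le_by_dyadic_approximation[OF x, of s l "(?t + s) / 2"]) auto
    qed
    have "x ?t \<le> x s" if "s \<in> {(?t + a) / 2..?t}" for s
      using that min[of s] by (cases "s = ?t") (auto simp: a_def)
    moreover have "(?t + a) / 2 < ?t" "0 \<le> (?t + a) / 2"
      using a0 binary_real_bounds[of \<nu>] by (auto simp: a_def)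
    ultimately show ?thesis
      unfolding local_minimizers_def using binary_real_bounds[of \<nu>]
      by (intro CollectI exI[of _ ?t] exI[of _ "(?t + a) / 2"]) auto
  qed
qed

text \<open>Since \<open>x\<close> is continuous, its value at \<open>binary_real \<nu>\<close> need not be computed: comparing with
  the values at dyadic approximations of \<open>\<nu>\<close> infinitely often suffices. The test \<open>Q N k\<close> may err by 9
  units of precision.\<close>

lemma le_iff_infinitely_often:
  fixes x :: "real \<Rightarrow> real"
  assumes x: "continuous_on {0..1} x"
    and Q1: "\<And>N k. x (real (digits \<nu> k) / 2 ^ k) < y + 1 / 2 ^ N \<Longrightarrow> Q N k"
    and Q2: "\<And>N k. Q N k \<Longrightarrow> x (real (digits \<nu> k) / 2 ^ k) < y + 9 / 2 ^ N"
  shows "x (binary_real \<nu>) \<le> y \<longleftrightarrow> (\<forall>N. \<exists>k\<ge>N. Q N k)"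
proof -
  have "0 \<le> real (digits \<nu> k) / 2 ^ k" "real (digits \<nu> k) / 2 ^ k \<le> 1" for k
    using digits_bounds(1)[of \<nu> k] binary_real_bounds(2)[of \<nu>] by (simp, linarith)
  then have lim: "(\<lambda>k. x (real (digits \<nu> k) / 2 ^ k)) \<longlonglongrightarrow> x (binary_real \<nu>)"
    using continuous_on_tendsto_compose[OF x digits_tendsto] binary_real_bounds by simp
  show ?thesis
  proof
    assume le: "x (binary_real \<nu>) \<le> y"
    show "\<forall>N. \<exists>k\<ge>N. Q N k"
    proof
      fix N :: nat
      have "x (binary_real \<nu>) < y + 1 / 2 ^ N"
        using le by (simp add: add_pos_nonneg less_add_same_cancel1 order_le_less_trans)
      then have "\<forall>\<^sub>F k in sequentially. x (real (digits \<nu> k) / 2 ^ k) < y + 1 / 2 ^ N"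
        by (rule order_tendstoD(2)[OF lim])
      then have "\<forall>\<^sub>F k in sequentially. N \<le> k \<and> Q N k"
        using eventually_ge_at_top[of N] by eventually_elim (use Q1 in blast)
      then show "\<exists>k\<ge>N. Q N k"
        by (auto dest: eventually_happens)
    qed
  next
    assume "\<forall>N. \<exists>k\<ge>N. Q N k"
    \<comment> \<open>The condition k \<ge> N makes the chosen truncations converge to t while the
      tolerance shrinks.\<close>
    then obtain k where k: "\<And>N. k N \<ge> N" "\<And>N. Q N (k N)"
      by metis
    have "filterlim k at_top sequentially"
      using k(1) by (intro filterlim_at_top_mono[OF filterlim_ident]) auto
    then have l1: "(\<lambda>N. x (real (digits \<nu> (k N)) / 2 ^ k N)) \<longlonglongrightarrow> x (binary_real \<nu>)"
      by (rule filterlim_compose[OF lim])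
    have "(\<lambda>N. y + 9 * (1 / 2) ^ N) \<longlonglongrightarrow> y + 9 * 0"
      by (intro tendsto_intros LIMSEQ_power_zero) auto
    then have l2: "(\<lambda>N. y + 9 / 2 ^ N) \<longlonglongrightarrow> y"
      by (simp add: power_divide)
    show "x (binary_real \<nu>) \<le> y"
      by (rule tendsto_le[OF _ l2 l1]) (auto intro!: always_eventually less_imp_le Q2 k(2))
  qed
qed

section \<open>Coded tuples\<close>

text \<open>No length is stored: iterated pairing makes every number a tuple of every length, so
  each value of a single quantifier decodes to something.\<close>

primrec coord :: "nat \<Rightarrow> nat \<Rightarrow> nat" where
  "coord 0 b = fst (prod_decode b)"
| "coord (Suc j) b = coord j (snd (prod_decode b))"

lemma ex_tuple: "\<exists>b. \<forall>j<length xs. coord j b = xs ! j"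
proof (induction xs)
  case (Cons x xs)
  then obtain b where "\<forall>j<length xs. coord j b = xs ! j"
    by blast
  then show ?case
    by (intro exI[of _ "prod_encode (x, b)"]) (auto simp: nth_Cons split: nat.splits)
qed simp

lemma computable_triangle:
  assumes "computable S n f"
  shows "computable S n (\<lambda>\<alpha> \<nu> xs. triangle (f \<alpha> \<nu> xs))"
  unfolding triangle_def by (intro computable_intros assms)

lemma computable_prod_decode:
  assumes f: "computable S n f"
  shows "computable S n (\<lambda>\<alpha> \<nu> xs. fst (prod_decode (f \<alpha> \<nu> xs)))"
    and "computable S n (\<lambda>\<alpha> \<nu> xs. snd (prod_decode (f \<alpha> \<nu> xs)))"
proof -
  \<comment> \<open>\<open>prod_encode (x, y)\<close> is \<open>triangle (x + y) + x\<close>. The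
    search finds the diagonal x + y, from which x and then y are obtained by subtraction.\<close>
  let ?L = "\<lambda>b. LEAST s. \<not> triangle (Suc s) \<le> b"
  have L: "?L b = fst (prod_decode b) + snd (prod_decode b)" for b
  proof -
    obtain x y where b: "b = prod_encode (x, y)"
      by (metis prod_decode_inverse surj_pair)
    have mono: "triangle (Suc s) \<le> triangle s'" if "s < s'" for s s'
      using that by (induction s') (auto simp: less_Suc_eq)
    have "?L b = x + y"
    proof (rule Least_equality)
      show "\<not> triangle (Suc (x + y)) \<le> b"
        by (simp add: b prod_encode_def)
      fix s assume s: "\<not> triangle (Suc s) \<le> b"
      show "x + y \<le> s"
      proof (rule ccontr)
        assume "\<not> x + y \<le> s"
        then have "triangle (Suc s) \<le> triangle (x + y)"
          by (intro mono) simp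
        then show False
          using s by (simp add: b prod_encode_def)
      qed
    qed
    then show ?thesis
      by (simp add: b)
  qed
  have fst_eq: "fst (prod_decode b) = b - triangle (?L b)" for b
  proof -
    obtain x y where b: "b = prod_encode (x, y)"
      by (metis prod_decode_inverse surj_pair)
    show ?thesis
      unfolding L by (simp add: b) (simp add: prod_encode_def)
  qed
  have ex: "\<exists>s. \<not> triangle (Suc s) \<le> b" for b
    by (intro exI[of _ b]) simp
  let ?t = "\<lambda>\<alpha> \<nu> ys. of_bool (triangle (Suc (ys ! 0)) \<le> f \<alpha> \<nu> (tl ys)) :: nat"
  have t: "computable S (Suc n) ?t"
    by (intro computable_intros computable_triangle computable_tl f) auto
  have "computable S n (\<lambda>\<alpha> \<nu> xs. LEAST s. ?t \<alpha> \<nu> (s # xs) = 0)"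
    by (rule computable_Least[OF t]) (use ex in simp)
  then have c: "computable S n (\<lambda>\<alpha> \<nu> xs. ?L (f \<alpha> \<nu> xs))"
    by simp
  show 1: "computable S n (\<lambda>\<alpha> \<nu> xs. fst (prod_decode (f \<alpha> \<nu> xs)))"
    unfolding fst_eq by (intro computable_diff computable_triangle f c)
  have "computable S n (\<lambda>\<alpha> \<nu> xs. ?L (f \<alpha> \<nu> xs) - fst (prod_decode (f \<alpha> \<nu> xs)))"
    by (intro computable_diff c 1)
  then show "computable S n (\<lambda>\<alpha> \<nu> xs. snd (prod_decode (f \<alpha> \<nu> xs)))"
    unfolding L by simp
qed

lemma computable_coord:
  assumes "computable S n f"
  shows "computable S n (\<lambda>\<alpha> \<nu> xs. coord j (f \<alpha> \<nu> xs))"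
  using assms by (induction j arbitrary: f) (auto intro: computable_prod_decode)

lemma computable_fuel_compose:
  assumes c: "computable S n c" and gs: "list_all (computable S n) gs"
  shows "computable S n (\<lambda>\<alpha> \<nu> xs. fuel (take k [\<alpha>, \<nu>]) p (c \<alpha> \<nu> xs) (map (\<lambda>g. g \<alpha> \<nu> xs) gs))"
proof -
  have "computable S n (\<lambda>\<alpha> \<nu> xs. (\<lambda>\<alpha> \<nu> ys. fuel (take k [\<alpha>, \<nu>]) p (hd ys) (tl ys)) \<alpha> \<nu>
      (map (\<lambda>g. g \<alpha> \<nu> xs) (c # gs)))"
  proof (rule computable_compose)
    show "computable S (length (c # gs)) (\<lambda>\<alpha> \<nu> ys. fuel (take k [\<alpha>, \<nu>]) p (hd ys) (tl ys))"
      unfolding list.size by (simp add: computable_fuel)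
  qed (use c gs in \<open>auto simp: list_all_iff\<close>)
  then show ?thesis by simp
qed

section \<open>Minimizers of complex oscillations\<close>

lemma fouche_bijection_continuous:
  assumes "fouche_bijection U \<Phi>" "\<alpha> \<in> KC U"
  shows "continuous_on {0..1} (\<Phi> \<alpha>)"
proof -
  have "\<Phi> \<alpha> \<in> complex_oscillations U"
    using assms unfolding fouche_bijection_def bij_betw_def by blast
  then show ?thesis
    by (simp add: complex_oscillations_def)
qed

lemma oscillation_le_iff:
  assumes \<Phi>: "fouche_bijection U \<Phi>"
  obtains p where "\<And>\<alpha> \<nu> i m. \<alpha> \<in> KC U \<Longrightarrow> i \<le> 2 ^ m \<Longrightarrow>
    \<Phi> \<alpha> (binary_real \<nu>) \<le> \<Phi> \<alpha> (real i / 2 ^ m) \<longleftrightarrow> (\<forall>N. \<exists>k\<ge>N. \<exists>c. fuel [\<alpha>, \<nu>] p c [N, k, i, m] = 2)"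
proof -
  obtain \<xi>0 \<xi>1 \<xi> where \<xi>0: "computable_reals_on (KC U) {[]} (\<lambda>\<alpha> _. \<xi>0 \<alpha>)"
    and \<xi>1: "computable_reals_on (KC U) {[]} (\<lambda>\<alpha> _. \<xi>1 \<alpha>)"
    and \<xi>: "computable_reals_on (KC U) {[j, n] | j n. 1 \<le> j \<and> n < 2 ^ j} (\<lambda>\<alpha> xs. \<xi> \<alpha> (xs ! 0) (xs ! 1))"
    and rec: "\<And>\<alpha>. \<alpha> \<in> KC U \<Longrightarrow> dyadic_recursion (\<xi>0 \<alpha>) (\<xi>1 \<alpha>) (\<xi> \<alpha>) (\<Phi> \<alpha>)"
    using \<Phi> unfolding fouche_bijection_def by blast
  let ?x = "\<lambda>\<alpha>. schauder_sum (\<xi>0 \<alpha>) (\<xi>1 \<alpha>) (\<xi> \<alpha>)"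
  \<comment> \<open>The list is k, i, m. \<open>?F\<close> is the value at the k-digit truncation of
    \<nu>, and \<open>?G\<close> the value at i / 2^m.\<close>
  let ?F = "\<lambda>\<alpha> \<nu> xs. ?x \<alpha> (xs ! 0) (digits \<nu> (xs ! 0))"
  let ?G = "\<lambda>\<alpha> \<nu> xs. ?x \<alpha> (xs ! 2) (xs ! 1)"
  have F: "computable_real (KC U) 3 ?F"
    by (intro computable_real_schauder_sum[OF \<xi>0 \<xi>1 \<xi>] computable_digits computable_nth) auto
  have G: "computable_real (KC U) 3 ?G"
    by (intro computable_real_schauder_sum[OF \<xi>0 \<xi>1 \<xi>] computable_nth) auto
  obtain Q where Q: "computable (KC U) (Suc 3) (\<lambda>\<alpha> \<nu> ys. of_bool (Q \<alpha> \<nu> ys))"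
    and Q1: "\<And>\<alpha> \<nu> k xs. \<alpha> \<in> KC U \<Longrightarrow> length xs = 3 \<Longrightarrow> ?F \<alpha> \<nu> xs < ?G \<alpha> \<nu> xs + 1 / 2 ^ k \<Longrightarrow> Q \<alpha> \<nu> (k # xs)"
    and Q2: "\<And>\<alpha> \<nu> k xs. \<alpha> \<in> KC U \<Longrightarrow> length xs = 3 \<Longrightarrow> Q \<alpha> \<nu> (k # xs) \<Longrightarrow> ?F \<alpha> \<nu> xs < ?G \<alpha> \<nu> xs + 9 / 2 ^ k"
    using computable_real_less[OF F G] by metis
  obtain p where p: "\<And>\<alpha> \<nu> ys. \<alpha> \<in> KC U \<Longrightarrow> length ys = Suc 3 \<Longrightarrow> computes [\<alpha>, \<nu>] p ys (of_bool (Q \<alpha> \<nu> ys))"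
    using Q unfolding computable_def by blast
  show thesis
  proof (rule that[of p])
    fix \<alpha> \<nu> :: cantor and i m :: nat
    assume \<alpha>: "\<alpha> \<in> KC U" and i: "i \<le> 2 ^ m"
    \<comment> \<open>The value 2 is \<open>Suc 1\<close>: the simulation has halted with the answer
      true.\<close>
    have fuel: "(\<exists>c. fuel [\<alpha>, \<nu>] p c [N, k, i, m] = 2) \<longleftrightarrow> Q \<alpha> \<nu> [N, k, i, m]" for N k
    proof -
      have "(\<exists>c. fuel [\<alpha>, \<nu>] p c [N, k, i, m] = Suc 1) \<longleftrightarrow> computes [\<alpha>, \<nu>] p [N, k, i, m] 1"
        by (rule computes_iff_fuel[symmetric])
      moreover have c: "computes [\<alpha>, \<nu>] p [N, k, i, m] (of_bool (Q \<alpha> \<nu> [N, k, i, m]))"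
        by (rule p[OF \<alpha>]) simp
      ultimately show ?thesis
        using computes_deterministic[OF c, of 1] by (auto simp: numeral_2_eq_2 of_bool_def split: if_splits)
    qed
    have value_at: "\<Phi> \<alpha> (real i / 2 ^ m) = ?x \<alpha> m i" if "i \<le> 2 ^ m" for i m
      by (rule dyadic_recursion_eq_schauder_sum[OF rec[OF \<alpha>] that])
    from fouche_bijection_continuous[OF \<Phi> \<alpha>] show "\<Phi> \<alpha> (binary_real \<nu>) \<le> \<Phi> \<alpha> (real i / 2 ^ m) \<longleftrightarrow>
        (\<forall>N. \<exists>k\<ge>N. \<exists>c. fuel [\<alpha>, \<nu>] p c [N, k, i, m] = 2)"
      unfolding fuel
    proof (rule le_iff_infinitely_often)
      fix N k :: nat
      note v = value_at[OF less_imp_le[OF digits_less[of \<nu> k]]] value_at[OF i]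
      show "\<Phi> \<alpha> (real (digits \<nu> k) / 2 ^ k) < \<Phi> \<alpha> (real i / 2 ^ m) + 1 / 2 ^ N \<Longrightarrow> Q \<alpha> \<nu> [N, k, i, m]"
        using Q1[OF \<alpha>, of "[k, i, m]" \<nu> N] unfolding v by simp
      show "Q \<alpha> \<nu> [N, k, i, m] \<Longrightarrow> \<Phi> \<alpha> (real (digits \<nu> k) / 2 ^ k) < \<Phi> \<alpha> (real i / 2 ^ m) + 9 / 2 ^ N"
        using Q2[OF \<alpha>, of "[k, i, m]" \<nu> N] unfolding v by simp
    qed
  qed
qed

theorem theorem5:
  fixes U :: machine and \<Phi> :: "cantor \<Rightarrow> real \<Rightarrow> real"
  assumes "optimal_machine U"
    and "fouche_bijection U \<Phi>"
  shows "\<exists>C. Sigma03 C \<and>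
    (\<forall>\<alpha> \<nu>. C \<alpha> \<nu> \<longleftrightarrow> (binary_real \<nu> \<in> local_minimizers (\<Phi> \<alpha>) \<and> \<alpha> \<in> KC U))"
proof -
  obtain u where u: "\<And>v w. computes [] u [word_code v] (word_code w) \<longleftrightarrow> U v = Some w"
    using assms(1) unfolding optimal_machine_def prefix_free_machine_def by blast
  obtain p where p: "\<And>\<alpha> \<nu> i m. \<alpha> \<in> KC U \<Longrightarrow> i \<le> 2 ^ m \<Longrightarrow>
      \<Phi> \<alpha> (binary_real \<nu>) \<le> \<Phi> \<alpha> (real i / 2 ^ m) \<longleftrightarrow> (\<forall>N. \<exists>k\<ge>N. \<exists>c. fuel [\<alpha>, \<nu>] p c [N, k, i, m] = 2)"
    using oscillation_le_iff[OF assms(2)] by blast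

  define random where "random \<alpha> d n v c \<longleftrightarrow>
      (v + 1 < 2 ^ (n - d) \<longrightarrow> \<not> fuel [] u c [v] = Suc (word_code (map \<alpha> [0..<n])))" for \<alpha> d n v c
  define minimal where "minimal \<alpha> \<nu> J s m i N k c \<longleftrightarrow>
      (J \<le> m \<longrightarrow> fits s J m (digits \<nu> m) \<and>
        (near s J m (digits \<nu> m) i \<longrightarrow> N \<le> k \<and> fuel [\<alpha>, \<nu>] p c [N, k, i, m] = 2))" for \<alpha> \<nu> J s m i N k c
  \<comment> \<open>The variable a codes (d, J, side), b codes (n, v, bound of the machine
    simulation, m, i, N), and c codes (k, bound of the comparison simulation).\<close>
  define R where "R \<alpha> \<nu> a b c \<longleftrightarrow>
      random \<alpha> (coord 0 a) (coord 0 b) (coord 1 b) (coord 2 b) \<and>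
      minimal \<alpha> \<nu> (coord 1 a) (coord 2 a) (coord 3 b) (coord 4 b) (coord 5 b) (coord 0 c) (coord 1 c)"
    for \<alpha> \<nu> a b c

  \<comment> \<open>Decidability holds for all oracles because programs occur only inside
    \<open>fuel\<close>, which is total.\<close>
  have "computable UNIV 3 (\<lambda>\<alpha> \<nu> xs. of_bool (R \<alpha> \<nu> (xs ! 0) (xs ! 1) (xs ! 2)))"
  proof -
    have c: "computable UNIV 3 (\<lambda>\<alpha> \<nu> xs. coord j (xs ! i))" if "i < 3" for i j
      by (rule computable_coord[OF computable_nth[OF that]])
    have fu: "computable UNIV 3 (\<lambda>\<alpha> \<nu> xs. fuel [] u (coord 2 (xs ! 1)) [coord 1 (xs ! 1)])"
      using computable_fuel_compose[of UNIV 3 "\<lambda>\<alpha> \<nu> xs. coord 2 (xs ! 1)" "[\<lambda>\<alpha> \<nu> xs. coord 1 (xs ! 1)]" 0 u]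
      by (simp add: c del: coord.simps One_nat_def)
    have fp: "computable UNIV 3 (\<lambda>\<alpha> \<nu> xs. fuel [\<alpha>, \<nu>] p (coord 1 (xs ! 2))
        [coord 5 (xs ! 1), coord 0 (xs ! 2), coord 4 (xs ! 1), coord 3 (xs ! 1)])"
      using computable_fuel_compose[of UNIV 3 "\<lambda>\<alpha> \<nu> xs. coord 1 (xs ! 2)"
          "[\<lambda>\<alpha> \<nu> xs. coord 5 (xs ! 1), \<lambda>\<alpha> \<nu> xs. coord 0 (xs ! 2), \<lambda>\<alpha> \<nu> xs. coord 4 (xs ! 1),
            \<lambda>\<alpha> \<nu> xs. coord 3 (xs ! 1)]" 2 p]
      by (simp add: c del: coord.simps One_nat_def)
    show ?thesis
      unfolding R_def random_def minimal_def fits_def near_def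
      by (intro computable_intros computable_word_code computable_digits fu fp c) simp_all
  qed
  then obtain r where "\<And>\<alpha> \<nu> xs. length xs = 3 \<Longrightarrow>
      computes [\<alpha>, \<nu>] r xs (of_bool (R \<alpha> \<nu> (xs ! 0) (xs ! 1) (xs ! 2)))"
    unfolding computable_def by blast
  from this[of "[_, _, _]"] have r: "computes [\<alpha>, \<nu>] r [a, b, c] (of_bool (R \<alpha> \<nu> a b c))" for \<alpha> \<nu> a b c
    by simp

  have KC: "\<alpha> \<in> KC U \<longleftrightarrow> (\<exists>d. \<forall>n v c. random \<alpha> d n v c)" for \<alpha>
    unfolding random_def by (rule KC_iff_fuel[OF u])
  have MIN: "binary_real \<nu> \<in> local_minimizers (\<Phi> \<alpha>) \<longleftrightarrow> (\<exists>J s. \<forall>m i N. \<exists>k c. minimal \<alpha> \<nu> J s m i N k c)"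
    if \<alpha>: "\<alpha> \<in> KC U" for \<alpha> \<nu>
  proof -
    from fouche_bijection_continuous[OF assms(2) \<alpha>] have "binary_real \<nu> \<in> local_minimizers (\<Phi> \<alpha>) \<longleftrightarrow>
        (\<exists>J s. \<forall>m\<ge>J. fits s J m (digits \<nu> m) \<and> (\<forall>i. near s J m (digits \<nu> m) i \<longrightarrow>
          \<Phi> \<alpha> (binary_real \<nu>) \<le> \<Phi> \<alpha> (real i / 2 ^ m)))"
      by (rule local_minimizers_iff)
    also have "\<dots> \<longleftrightarrow> (\<exists>J s. \<forall>m\<ge>J. fits s J m (digits \<nu> m) \<and> (\<forall>i. near s J m (digits \<nu> m) i \<longrightarrow>
          (\<forall>N. \<exists>k\<ge>N. \<exists>c. fuel [\<alpha>, \<nu>] p c [N, k, i, m] = 2)))"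
      \<comment> \<open>\<open>near_le\<close> supplies the side condition i \<le> 2^m under which
        \<open>p\<close> is correct.\<close>
      using p[OF \<alpha> near_le] by meson
    \<comment> \<open>Prenexing: k and c matter only for near points, and any values serve
      elsewhere.\<close>
    also have "\<dots> \<longleftrightarrow> (\<exists>J s. \<forall>m i N. \<exists>k c. minimal \<alpha> \<nu> J s m i N k c)"
      unfolding minimal_def by (intro ex_cong1) blast
    finally show ?thesis .
  qed

  have "(\<exists>a. \<forall>b. \<exists>c. R \<alpha> \<nu> a b c) \<longleftrightarrow> binary_real \<nu> \<in> local_minimizers (\<Phi> \<alpha>) \<and> \<alpha> \<in> KC U" for \<alpha> \<nu>
  proof
    assume "\<exists>a. \<forall>b. \<exists>c. R \<alpha> \<nu> a b c"
    then obtain a where a: "\<And>b. \<exists>c. R \<alpha> \<nu> a b c"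
      by blast
    \<comment> \<open>The coordinates of b are independent, so the randomness test and the
      minimality test can be instantiated separately.\<close>
    have *: "random \<alpha> (coord 0 a) n v w \<and> (\<exists>k c. minimal \<alpha> \<nu> (coord 1 a) (coord 2 a) m i N k c)"
      for n v w m i N
    proof -
      obtain b where b: "\<forall>j<length [n, v, w, m, i, N]. coord j b = [n, v, w, m, i, N] ! j"
        using ex_tuple by blast
      have "coord 0 b = n" "coord 1 b = v" "coord 2 b = w" "coord 3 b = m" "coord 4 b = i" "coord 5 b = N"
        using b[rule_format, of 0] b[rule_format, of 1] b[rule_format, of 2] b[rule_format, of 3]
          b[rule_format, of 4] b[rule_format, of 5] by simp_all
      then show ?thesis
        using a[of b] unfolding R_def by auto
    qed
    \<comment> \<open>Membership in \<open>KC U\<close> comes first, from the randomness part alone;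
      only then does the simulated comparison have its meaning and \<open>MIN\<close> apply.\<close>
    then have "\<alpha> \<in> KC U"
      unfolding KC by blast
    with * MIN show "binary_real \<nu> \<in> local_minimizers (\<Phi> \<alpha>) \<and> \<alpha> \<in> KC U"
      by blast
  next
    assume "binary_real \<nu> \<in> local_minimizers (\<Phi> \<alpha>) \<and> \<alpha> \<in> KC U"
    then obtain d J s where d: "\<And>n v c. random \<alpha> d n v c"
      and J: "\<And>m i N. \<exists>k c. minimal \<alpha> \<nu> J s m i N k c"
      using KC MIN by blast
    obtain a where "\<forall>j<length [d, J, s]. coord j a = [d, J, s] ! j"
      using ex_tuple by blast
    then have a: "coord 0 a = d" "coord 1 a = J" "coord 2 a = s"
      by (auto simp: less_Suc_eq numeral_2_eq_2)
    have "\<exists>c. R \<alpha> \<nu> a b c" for b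
    proof -
      obtain k c' where kc: "minimal \<alpha> \<nu> J s (coord 3 b) (coord 4 b) (coord 5 b) k c'"
        using J by blast
      obtain c where "\<forall>j<length [k, c']. coord j c = [k, c'] ! j"
        using ex_tuple by blast
      then have "coord 0 c = k" "coord 1 c = c'"
        by (auto simp: less_Suc_eq)
      then show ?thesis
        unfolding R_def a using d kc by blast
    qed
    then show "\<exists>a. \<forall>b. \<exists>c. R \<alpha> \<nu> a b c"
      by blast
  qed
  with r show ?thesis
    unfolding Sigma03_def
    by (intro exI[of _ "\<lambda>\<alpha> \<nu>. \<exists>a. \<forall>b. \<exists>c. R \<alpha> \<nu> a b c"] conjI exI[of _ R] exI[of _ r]) auto
qed

end
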